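(* Let $p>1$, $a\in\mathbb{R}$, $R\ge 1$, and let $(f,g)\in C_0^2(\mathbb{R})\times C_0^1(\mathbb{R})$ satisfy $\operatorname{supp} f,\ \operatorname{supp} g\subset\{x\in\mathbb{R}:|x|\le R\}$. Then there exist a constant $\varepsilon_1=\varepsilon_1(f,g,p,a,R)>0$ and a constant $c>0$ independent of $\varepsilon$ such that, for every $\varepsilon$ with $0<\varepsilon\le\varepsilon_1$ and every $T>0$ satisfying $$T\le c\,\varepsilon^{-(p-1)/(-a)}\ \text{ if } a<0,\qquad T\le \exp\left(c\,\varepsilon^{-(p-1)}\right)\ \text{ if } a=0,\qquad T<\infty\ \text{ (no further restriction) if } a>0,$$ the following holds. (i) If $p\ge 2$, there exists a classical solution $u\in C^2(\mathbb{R}\times[0,T])$ of the initial value problem $$u_{tt}-u_{xx}=\frac{|u_t|^p}{(1+x^2)^{(1+a)/2}}\ \text{ in } \mathbb{R}\times(0,T],\qquad u(x,0)=\varepsilon f(x),\quad u_t(x,0)=\varepsilon g(x)\quad (x\in\mathbb{R}).$$ (ii) If $1<p<2$, there exists a function $U\in C(\mathbb{R}\times[0,T])$ with $\operatorname{supp} U\subset\{(x,t)\in\mathbb{R}\times[0,T]:|x|\le t+R\}$ which satisfies the integral equation $$U(x,t)=\varepsilon u_t^0(x,t)+L_a'(|U|^p)(x,t)\quad\text{for all }(x,t)\in\mathbb{R}\times[0,T].$$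
   Context: The function $u_t^0$ is the time derivative of the solution of the free wave equation with data $(f,g)$: $$u_t^0(x,t)=\frac12\{f'(x+t)-f'(x-t)+g(x+t)+g(x-t)\}.$$ For a continuous function $v=v(x,t)$ the linear operator $L_a'$ is defined by $$L_a'(v)(x,t):=\frac12\int_0^t\frac{v(x+t-s,s)}{\{1+(x+t-s)^2\}^{(1+a)/2}}\,ds+\frac12\int_0^t\frac{v(x-t+s,s)}{\{1+(x-t+s)^2\}^{(1+a)/2}}\,ds.$$ The integral equation in (ii) is the one associated with the initial value problem in (i): it is satisfied by $U=u_t$ whenever $u$ is a classical solution. $C_0^k(\mathbb{R})$ denotes the compactly supported $C^k$ functions on $\mathbb{R}$. *)

theory Defs
  imports "HOL-Analysis.Analysis"
begin

text \<open>Functions of space and time are curried, \<open>u x t\<close>, with space first.\<close>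

definition supp :: "'a::topological_space set \<Rightarrow> ('a \<Rightarrow> real) \<Rightarrow> 'a set" where
  "supp S v = closure (support_on S v)"

definition Ck :: "nat \<Rightarrow> (real \<Rightarrow> real) set" where
  "Ck k = {f. (\<forall>j<k. (deriv ^^ j) f differentiable_on UNIV) \<and> continuous_on UNIV ((deriv ^^ k) f)}"

definition Ck_compact_supp :: "nat \<Rightarrow> (real \<Rightarrow> real) set" where
  "Ck_compact_supp k = {f \<in> Ck k. compact (supp UNIV f)}"

definition strip :: "real \<Rightarrow> (real \<times> real) set" where
  "strip T = UNIV \<times> {0..T}"

definition dx :: "(real \<Rightarrow> real \<Rightarrow> real) \<Rightarrow> real \<Rightarrow> real \<Rightarrow> real" where
  "dx u x t = deriv (\<lambda>y. u y t) x"

text \<open>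
  The time derivative is taken relative to \<open>{0..T}\<close>, hence is two-sided for \<open>0 < t < T\<close> and
  one-sided at \<open>t = 0\<close> and \<open>t = T\<close>. For \<open>T > 0\<close> it is unique whenever it exists.
\<close>
definition dt :: "real \<Rightarrow> (real \<Rightarrow> real \<Rightarrow> real) \<Rightarrow> real \<Rightarrow> real \<Rightarrow> real" where
  "dt T u x t = vector_derivative (\<lambda>s. u x s) (at t within {0..T})"

text \<open>\<open>C\<^sup>k(\<real> \<times> [0,T])\<close>: all partial derivatives up to order \<open>k\<close>, mixed ones in every order
  included, exist and are continuous on the closed strip.\<close>
fun Ck_strip :: "nat \<Rightarrow> real \<Rightarrow> (real \<Rightarrow> real \<Rightarrow> real) \<Rightarrow> bool" where
  "Ck_strip 0 T u \<longleftrightarrow> continuous_on (strip T) (\<lambda>(x, t). u x t)"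
| "Ck_strip (Suc k) T u \<longleftrightarrow>
     continuous_on (strip T) (\<lambda>(x, t). u x t) \<and>
     (\<forall>x. \<forall>t\<in>{0..T}. (\<lambda>y. u y t) differentiable (at x)) \<and>
     (\<forall>x. \<forall>t\<in>{0..T}. (\<lambda>s. u x s) differentiable (at t within {0..T})) \<and>
     Ck_strip k T (dx u) \<and> Ck_strip k T (dt T u)"

definition classical_solution ::
  "real \<Rightarrow> real \<Rightarrow> (real \<Rightarrow> real) \<Rightarrow> (real \<Rightarrow> real) \<Rightarrow> real \<Rightarrow> real \<Rightarrow> (real \<Rightarrow> real \<Rightarrow> real) \<Rightarrow> bool" where
  "classical_solution p a f g \<epsilon> T u \<longleftrightarrow>
     Ck_strip 2 T u \<and>
     (\<forall>x. \<forall>t\<in>{0<..T}. dt T (dt T u) x t - dx (dx u) x t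
        = \<bar>dt T u x t\<bar> powr p / (1 + x\<^sup>2) powr ((1 + a) / 2)) \<and>
     (\<forall>x. u x 0 = \<epsilon> * f x) \<and>
     (\<forall>x. dt T u x 0 = \<epsilon> * g x)"

definition free_dt :: "(real \<Rightarrow> real) \<Rightarrow> (real \<Rightarrow> real) \<Rightarrow> real \<Rightarrow> real \<Rightarrow> real" where
  "free_dt f g x t = 1/2 * (deriv f (x + t) - deriv f (x - t) + g (x + t) + g (x - t))"

definition L' :: "real \<Rightarrow> (real \<Rightarrow> real \<Rightarrow> real) \<Rightarrow> real \<Rightarrow> real \<Rightarrow> real" where
  "L' a v x t =
     1/2 * integral {0..t} (\<lambda>s. v (x + t - s) s / (1 + (x + t - s)\<^sup>2) powr ((1 + a) / 2)) +
     1/2 * integral {0..t} (\<lambda>s. v (x - t + s) s / (1 + (x - t + s)\<^sup>2) powr ((1 + a) / 2))"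

end

theory Submission
  imports Defs
begin

text \<open>
  For a solution \<open>u\<close> each of \<open>u\<^sub>t + u\<^sub>x\<close> and \<open>u\<^sub>t - u\<^sub>x\<close> satisfies a transport equation, and
  \<open>u\<^sub>t\<close> is half their sum. Integration along characteristics turns the equation for \<open>U = u\<^sub>t\<close> into a
  fixed point problem: with
  \<open>\<alpha> = \<epsilon> (f' + g)\<close> and \<open>\<beta> = \<epsilon> (g - f')\<close> it reads \<open>U = \<Phi>(U)\<close>, where \<open>\<Phi>(U)\<close> is half the sum of
  \<open>\<alpha>(x + t)\<close>, \<open>\<beta>(x - t)\<close> and the integrals of the source
  \<open>\<bar>U\<bar>\<^sup>p / (1 + x\<^sup>2)\<^bsup>(1 + a) / 2\<^esup>\<close> along the two characteristics ending in \<open>(x, t)\<close>.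

  Existence. Finite propagation speed confines \<open>U\<close> to \<open>\<bar>x\<bar> \<le> t + R\<close>, and a characteristic has unit
  speed. So the integral of the weight along a characteristic, restricted to that region, is at
  most \<open>I(T)\<close>, the integral of the weight over \<open>\<bar>y\<bar> \<le> T + R\<close> (\<open>ray_int_bound\<close>). If \<open>M\<close> bounds
  \<open>\<bar>\<alpha>\<bar>\<close> and \<open>\<bar>\<beta>\<bar>\<close>, which is proportional to \<open>\<epsilon>\<close>, then on the functions bounded by \<open>2 M\<close> the map
  \<open>\<Phi>\<close> has Lipschitz constant \<open>p (2 M)\<^bsup>p - 1\<^esup> I(T)\<close>. Once this is at most \<open>1/2\<close>, the Picard iterates
  converge uniformly on the strip (\<open>picard_limit\<close>). The size of \<open>I(T)\<close> is what produces the three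
  regimes: it stays bounded for \<open>a > 0\<close>, grows like \<open>log T\<close> for \<open>a = 0\<close> and like \<open>T\<^bsup>-a\<^esup>\<close> for
  \<open>a < 0\<close> (\<open>wt_mass_growth\<close>), so that smallness of \<open>\<epsilon>\<^bsup>p - 1\<^esup> I(T)\<close> is guaranteed by the assumed
  bound on \<open>T\<close> (\<open>smallness\<close>).

  Regularity for \<open>p \<ge> 2\<close>. Differentiating the iteration in \<open>x\<close> gives an iteration for \<open>\<partial>\<^sub>x U\<close> that is
  affine in the new unknown. Its linear part has the same Lipschitz constant \<open>1/2\<close>, because
  \<open>p \<bar>U\<bar>\<^bsup>p - 1\<^esup>\<close> is the Lipschitz constant of \<open>\<bar>U\<bar>\<^sup>p\<close>, and its coefficients converge geometrically
  because \<open>\<bar>U\<bar>\<^bsup>p - 1\<^esup> sgn U\<close> is locally Lipschitz exactly when \<open>p \<ge> 2\<close>. Hence the derivatives of the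
  iterates converge uniformly too, and \<open>U\<close> is differentiable in \<open>x\<close> with continuous derivative
  (\<open>picard_limit_C1\<close>). This makes \<open>u(x, t) = \<epsilon> f(x) + \<integral>\<^sub>0\<^sup>t U(x, s) ds\<close> a \<open>C\<^sup>2\<close> solution of
  \<open>u\<^sub>t\<^sub>t - u\<^sub>x\<^sub>x = H\<close>, with \<open>H\<close> the source belonging to \<open>U\<close> (\<open>wave_potential\<close>). The
  point is that \<open>u\<^sub>x\<close> has its own representation by integrals along characteristics, from which it
  can be differentiated again.
\<close>

section \<open>Integrals along characteristics\<close>

lemma strip_compose:
  assumes "continuous_on (strip T) (case_prod H)" "continuous_on S b" "continuous_on S c"
    and "\<And>z. z \<in> S \<Longrightarrow> 0 \<le> c z \<and> c z \<le> T"
  shows "continuous_on S (\<lambda>z. H (b z) (c z))"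
proof -
  have "continuous_on S (\<lambda>z. case_prod H (b z, c z))"
    by (rule continuous_on_compose2[OF assms(1)])
      (use assms in \<open>auto simp: strip_def intro!: continuous_intros\<close>)
  then show ?thesis by simp
qed

text \<open>The line \<open>x - \<sigma> t = \<xi>\<close> is traversed from time \<open>0\<close> to time \<open>t\<close>. Keeping its label \<open>\<xi>\<close> instead of its
  end point as the argument separates the two ways in which the integral depends on \<open>(x, t)\<close>: as a
  parameter of the integrand and as the upper limit.\<close>
definition char_int :: "real \<Rightarrow> (real \<Rightarrow> real \<Rightarrow> real) \<Rightarrow> real \<Rightarrow> real \<Rightarrow> real" where
  "char_int \<sigma> H \<xi> t = integral {0..t} (\<lambda>s. H (\<xi> + \<sigma> * s) s)"

text \<open>Rescaling to a fixed interval turns the variable upper limit into a parameter of the integrand,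
  so that continuity in \<open>(\<xi>, t)\<close> follows from the theorem on integrals with parameters.\<close>
lemma char_int_rescaled:
  assumes "0 \<le> t"
  shows "char_int \<sigma> H \<xi> t = t * integral {0..1} (\<lambda>r. H (\<xi> + \<sigma> * (t * r)) (t * r))"
proof (cases "t = 0")
  case False
  then show ?thesis
    using integral_stretch_real[of t 0 t "\<lambda>s. H (\<xi> + \<sigma> * s) s"] assms
    by (simp add: char_int_def image_divide_atLeastAtMost)
qed (simp add: char_int_def)

lemma continuous_on_char_int:
  assumes "continuous_on (strip T) (case_prod H)"
  shows "continuous_on (strip T) (case_prod (char_int \<sigma> H))"
proof -
  have "continuous_on (strip T \<times> cbox 0 1)
      (\<lambda>w. H (fst (fst w) + \<sigma> * (snd (fst w) * snd w)) (snd (fst w) * snd w))"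
    by (rule strip_compose[OF assms])
      (auto simp: strip_def intro!: continuous_intros mult_le_one
        intro: order_trans[OF mult_right_le_one_le])
  then have "continuous_on (strip T \<times> cbox 0 1)
      (\<lambda>(z, r). H (fst z + \<sigma> * (snd z * r)) (snd z * r))"
    by (simp add: case_prod_beta)
  from integral_continuous_on_param[OF this]
  have "continuous_on (strip T)
      (\<lambda>z. snd z * integral {0..1} (\<lambda>r. H (fst z + \<sigma> * (snd z * r)) (snd z * r)))"
    by (auto intro!: continuous_intros)
  then show ?thesis
    by (rule continuous_on_eq) (auto simp: strip_def char_int_rescaled)
qed

lemma char_int_integrable:
  fixes H :: "real \<Rightarrow> real \<Rightarrow> real"
  assumes "continuous_on (strip T) (case_prod H)" "t \<le> T"
  shows "(\<lambda>s. H (\<xi> + \<sigma> * s) s) integrable_on {0..t}"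
proof (rule integrable_continuous_real)
  show "continuous_on {0..t} (\<lambda>s. H (\<xi> + \<sigma> * s) s)"
    by (intro strip_compose[OF assms(1)] continuous_intros) (use assms in auto)
qed

lemma char_int_has_derivative_space:
  assumes H: "continuous_on (strip T) (case_prod H)"
    and H': "continuous_on (strip T) (case_prod H')"
    and der: "\<And>x t. t \<in> {0..T} \<Longrightarrow> ((\<lambda>y. H y t) has_real_derivative H' x t) (at x)"
    and t: "t \<in> {0..T}"
  shows "((\<lambda>\<xi>. char_int \<sigma> H \<xi> t) has_real_derivative char_int \<sigma> H' \<xi> t) (at \<xi>)"
proof -
  have *: "continuous_on (UNIV \<times> cbox 0 t) (\<lambda>w. H' (fst w + \<sigma> * snd w) (snd w))"
    by (intro strip_compose[OF H'] continuous_intros) (use t in auto)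
  have "((\<lambda>\<xi>. integral (cbox 0 t) (\<lambda>s. H (\<xi> + \<sigma> * s) s)) has_real_derivative
      integral (cbox 0 t) (\<lambda>s. H' (\<xi> + \<sigma> * s) s)) (at \<xi> within UNIV)"
  proof (rule leibniz_rule_field_derivative)
    fix x s assume "s \<in> cbox 0 t"
    then show "((\<lambda>x. H (x + \<sigma> * s) s) has_real_derivative H' (x + \<sigma> * s) s) (at x within UNIV)"
      using der[of s "x + \<sigma> * s"] t by (simp add: DERIV_shift)
  next
    fix x show "(\<lambda>s. H (x + \<sigma> * s) s) integrable_on cbox 0 t"
      using char_int_integrable[OF H, of t x \<sigma>] t by simp
  qed (use * in \<open>auto simp: case_prod_beta\<close>)
  then show ?thesis by (simp add: char_int_def)
qed

text \<open>Both partial derivatives exist, by differentiation under the integral in \<open>\<xi>\<close> and by the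
  fundamental theorem of calculus in \<open>t\<close>. Continuity of the second one gives total
  differentiability on the closed strip, which is what the chain rule along \<open>\<xi> = x - \<sigma> t\<close> requires.\<close>
lemma char_int_has_derivative:
  assumes H: "continuous_on (strip T) (case_prod H)"
    and H': "continuous_on (strip T) (case_prod H')"
    and der: "\<And>x t. t \<in> {0..T} \<Longrightarrow> ((\<lambda>y. H y t) has_real_derivative H' x t) (at x)"
    and t: "t \<in> {0..T}"
  shows "(case_prod (char_int \<sigma> H) has_derivative
    (\<lambda>(h, k). char_int \<sigma> H' \<xi> t * h + H (\<xi> + \<sigma> * t) t * k)) (at (\<xi>, t) within strip T)"
proof -
  have "((\<lambda>(\<xi>, t). char_int \<sigma> H \<xi> t) has_derivative
    (\<lambda>(h, k). char_int \<sigma> H' \<xi> t * h + blinfun_scaleR_left (H (\<xi> + \<sigma> * t) t) k))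
    (at (\<xi>, t) within UNIV \<times> {0..T})"
  proof (rule has_derivative_partialsI[where fy = "\<lambda>\<xi> t. blinfun_scaleR_left (H (\<xi> + \<sigma> * t) t)"])
    show "((\<lambda>\<xi>. char_int \<sigma> H \<xi> t) has_derivative (*) (char_int \<sigma> H' \<xi> t)) (at \<xi> within UNIV)"
      using char_int_has_derivative_space[OF assms] by (simp add: has_field_derivative_def)
  next
    fix \<xi> t assume "t \<in> {0..T}"
    moreover have "continuous_on {0..T} (\<lambda>s. H (\<xi> + \<sigma> * s) s)"
      by (intro strip_compose[OF H] continuous_intros) auto
    ultimately have "((\<lambda>t. char_int \<sigma> H \<xi> t) has_real_derivative H (\<xi> + \<sigma> * t) t) (at t within {0..T})"
      unfolding char_int_def by (rule integral_has_real_derivative[rotated])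
    then show "((\<lambda>t. char_int \<sigma> H \<xi> t) has_derivative
        blinfun_apply (blinfun_scaleR_left (H (\<xi> + \<sigma> * t) t))) (at t within {0..T})"
      by (rule has_derivative_eq_rhs[OF has_field_derivative_imp_has_derivative])
        (auto simp: fun_eq_iff)
  next
    have "continuous_on (strip T) (\<lambda>z. blinfun_scaleR_left (H (fst z + \<sigma> * snd z) (snd z)))"
      by (intro bounded_linear.continuous_on[OF bounded_linear_blinfun_scaleR_left]
          strip_compose[OF H] continuous_intros) (auto simp: strip_def)
    then show "continuous (at (\<xi>, t) within UNIV \<times> {0..T})
        (\<lambda>(\<xi>, t). blinfun_scaleR_left (H (\<xi> + \<sigma> * t) t))"
      using t by (simp add: continuous_on_eq_continuous_within strip_def case_prod_beta')
  qed (use t in auto)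
  then show ?thesis by (simp add: strip_def mult.commute)
qed

text \<open>The same integral labelled by the end point \<open>(x, t)\<close> of the ray. For \<open>\<sigma> = 0\<close> this is the plain
  time integral at fixed \<open>x\<close>, so the rules below also cover \<open>\<integral>\<^sub>0\<^sup>t H(x, s) ds\<close>.\<close>
definition ray_int :: "real \<Rightarrow> (real \<Rightarrow> real \<Rightarrow> real) \<Rightarrow> real \<Rightarrow> real \<Rightarrow> real" where
  "ray_int \<sigma> H x t = char_int \<sigma> H (x - \<sigma> * t) t"

lemma ray_int_eq: "ray_int \<sigma> H x t = integral {0..t} (\<lambda>s. H (x - \<sigma> * t + \<sigma> * s) s)"
  by (simp add: ray_int_def char_int_def)

lemma ray_int_0 [simp]: "ray_int \<sigma> H x 0 = 0"
  by (simp add: ray_int_eq)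

lemma continuous_on_ray_int:
  assumes "continuous_on (strip T) (case_prod H)"
  shows "continuous_on (strip T) (case_prod (ray_int \<sigma> H))"
proof -
  have "continuous_on (strip T) (\<lambda>z. char_int \<sigma> H (fst z - \<sigma> * snd z) (snd z))"
    by (intro strip_compose[OF continuous_on_char_int[OF assms]] continuous_intros)
      (auto simp: strip_def)
  then show ?thesis by (simp add: ray_int_def case_prod_beta')
qed

lemma ray_int_has_derivative_space:
  assumes "continuous_on (strip T) (case_prod H)" "continuous_on (strip T) (case_prod H')"
    and "\<And>x t. t \<in> {0..T} \<Longrightarrow> ((\<lambda>y. H y t) has_real_derivative H' x t) (at x)"
    and "t \<in> {0..T}"
  shows "((\<lambda>y. ray_int \<sigma> H y t) has_real_derivative ray_int \<sigma> H' x t) (at x)"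
  using char_int_has_derivative_space[OF assms, of \<sigma> "x - \<sigma> * t"]
  by (simp add: ray_int_def DERIV_shift[of _ _ _ "- (\<sigma> * t)", simplified])

lemma ray_int_has_derivative_time:
  assumes "continuous_on (strip T) (case_prod H)" "continuous_on (strip T) (case_prod H')"
    and "\<And>x t. t \<in> {0..T} \<Longrightarrow> ((\<lambda>y. H y t) has_real_derivative H' x t) (at x)"
    and t: "t \<in> {0..T}"
  shows "((\<lambda>s. ray_int \<sigma> H x s) has_real_derivative H x t - \<sigma> * ray_int \<sigma> H' x t)
    (at t within {0..T})"
proof -
  define e where "e s = (x - \<sigma> * s, s)" for s
  have "(e has_derivative (\<lambda>k. (- \<sigma> * k, k))) (at t within {0..T})"
    unfolding e_def by (auto intro!: derivative_eq_intros)
  moreover have "(case_prod (char_int \<sigma> H) has_derivative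
      (\<lambda>(h, k). char_int \<sigma> H' (x - \<sigma> * t) t * h + H x t * k)) (at (e t) within e ` {0..T})"
    using char_int_has_derivative[OF assms, of \<sigma> "x - \<sigma> * t"]
    by (auto simp: e_def strip_def intro: has_derivative_subset)
  ultimately have "((\<lambda>s. case_prod (char_int \<sigma> H) (e s)) has_derivative
      (\<lambda>k. case (- \<sigma> * k, k) of (h, k) \<Rightarrow> char_int \<sigma> H' (x - \<sigma> * t) t * h + H x t * k))
      (at t within {0..T})"
    by (rule has_derivative_in_compose)
  moreover have "(\<lambda>k. case (- \<sigma> * k, k) of (h, k) \<Rightarrow>
      char_int \<sigma> H' (x - \<sigma> * t) t * h + H x t * k) = (*) (H x t - \<sigma> * ray_int \<sigma> H' x t)"
    by (auto simp: ray_int_def algebra_simps)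
  ultimately show ?thesis
    by (simp add: has_field_derivative_def e_def ray_int_def)
qed

section \<open>The wave equation as two transport equations\<close>

text \<open>This is the solution of \<open>A\<^sub>t + \<sigma> A\<^sub>x = H\<close> with \<open>A = \<alpha>\<close> at time \<open>0\<close>. A solution of
  \<open>u\<^sub>t\<^sub>t - u\<^sub>x\<^sub>x = H\<close> has \<open>u\<^sub>t + u\<^sub>x\<close> of this form with \<open>\<sigma> = -1\<close> and \<open>u\<^sub>t - u\<^sub>x\<close> with \<open>\<sigma> = 1\<close>.\<close>
definition transport :: "real \<Rightarrow> (real \<Rightarrow> real) \<Rightarrow> (real \<Rightarrow> real \<Rightarrow> real) \<Rightarrow> real \<Rightarrow> real \<Rightarrow> real" where
  "transport \<sigma> \<alpha> H x t = \<alpha> (x - \<sigma> * t) + ray_int \<sigma> H x t"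

text \<open>The time derivative \<open>u\<^sub>t\<close> of the solution of \<open>u\<^sub>t\<^sub>t - u\<^sub>x\<^sub>x = H\<close> whose initial values satisfy
  \<open>u\<^sub>t + u\<^sub>x = \<alpha>\<close> and \<open>u\<^sub>t - u\<^sub>x = \<beta>\<close>.\<close>
definition wave :: "(real \<Rightarrow> real) \<Rightarrow> (real \<Rightarrow> real) \<Rightarrow> (real \<Rightarrow> real \<Rightarrow> real) \<Rightarrow> real \<Rightarrow> real \<Rightarrow> real" where
  "wave \<alpha> \<beta> H x t = 1/2 * (transport (- 1) \<alpha> H x t + transport 1 \<beta> H x t)"

lemma continuous_on_transport:
  assumes "continuous_on UNIV \<alpha>" "continuous_on (strip T) (case_prod H)"
  shows "continuous_on (strip T) (case_prod (transport \<sigma> \<alpha> H))"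
proof -
  have "continuous_on (strip T) (\<lambda>z. \<alpha> (fst z - \<sigma> * snd z) + case_prod (ray_int \<sigma> H) z)"
    by (intro continuous_intros continuous_on_compose2[OF assms(1)]
        continuous_on_ray_int[OF assms(2)]) auto
  then show ?thesis by (simp add: transport_def case_prod_beta')
qed

lemma transport_has_derivative_space:
  assumes "\<And>y. (\<alpha> has_real_derivative \<alpha>' y) (at y)"
    and "continuous_on (strip T) (case_prod H)" "continuous_on (strip T) (case_prod H')"
    and "\<And>x t. t \<in> {0..T} \<Longrightarrow> ((\<lambda>y. H y t) has_real_derivative H' x t) (at x)"
    and "t \<in> {0..T}"
  shows "((\<lambda>y. transport \<sigma> \<alpha> H y t) has_real_derivative transport \<sigma> \<alpha>' H' x t) (at x)"
  unfolding transport_def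
  by (auto intro!: derivative_eq_intros DERIV_chain2[OF assms(1)]
      ray_int_has_derivative_space[OF assms(2-5)])

lemma transport_has_derivative_time:
  assumes "\<And>y. (\<alpha> has_real_derivative \<alpha>' y) (at y)"
    and "continuous_on (strip T) (case_prod H)" "continuous_on (strip T) (case_prod H')"
    and "\<And>x t. t \<in> {0..T} \<Longrightarrow> ((\<lambda>y. H y t) has_real_derivative H' x t) (at x)"
    and "t \<in> {0..T}"
  shows "((\<lambda>s. transport \<sigma> \<alpha> H x s) has_real_derivative
    H x t - \<sigma> * transport \<sigma> \<alpha>' H' x t) (at t within {0..T})"
proof -
  have "((\<lambda>s. x - \<sigma> * s) has_real_derivative - \<sigma>) (at t within {0..T})"
    by (auto intro!: derivative_eq_intros)
  from DERIV_add[OF DERIV_chain2[OF assms(1) this] ray_int_has_derivative_time[OF assms(2-5)]]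
  show ?thesis by (simp add: transport_def algebra_simps)
qed

lemma continuous_on_wave:
  assumes "continuous_on UNIV \<alpha>" "continuous_on UNIV \<beta>" "continuous_on (strip T) (case_prod H)"
  shows "continuous_on (strip T) (case_prod (wave \<alpha> \<beta> H))"
proof -
  have "continuous_on (strip T) (\<lambda>z. 1/2 *
      (case_prod (transport (- 1) \<alpha> H) z + case_prod (transport 1 \<beta> H) z))"
    using assms by (intro continuous_intros continuous_on_transport)
  then show ?thesis by (simp add: wave_def case_prod_beta')
qed

lemma wave_has_derivative_space:
  assumes "\<And>y. (\<alpha> has_real_derivative \<alpha>' y) (at y)" "\<And>y. (\<beta> has_real_derivative \<beta>' y) (at y)"
    and "continuous_on (strip T) (case_prod H)" "continuous_on (strip T) (case_prod H')"
    and "\<And>x t. t \<in> {0..T} \<Longrightarrow> ((\<lambda>y. H y t) has_real_derivative H' x t) (at x)"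
    and "t \<in> {0..T}"
  shows "((\<lambda>y. wave \<alpha> \<beta> H y t) has_real_derivative wave \<alpha>' \<beta>' H' x t) (at x)"
  unfolding wave_def
  by (intro DERIV_cmult DERIV_add transport_has_derivative_space[OF assms(1,3-6)]
      transport_has_derivative_space[OF assms(2,3-6)])

text \<open>On \<open>strip T\<close> the spatial derivative only sees one time slice and the time derivative is taken
  within \<open>{0..T}\<close>, so values outside the strip never enter.\<close>
lemma Ck_strip_cong:
  assumes "\<And>x t. t \<in> {0..T} \<Longrightarrow> u x t = v x t"
  shows "Ck_strip k T u \<longleftrightarrow> Ck_strip k T v"
  using assms
proof (induction k arbitrary: u v)
  case 0
  then show ?case by (auto simp: strip_def intro!: continuous_on_cong)
next
  case (Suc k)
  have dx: "dx u x t = dx v x t" if "t \<in> {0..T}" for x t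
    using Suc.prems that by (simp add: dx_def)
  have vd: "((\<lambda>s. u x s) has_vector_derivative d) (at t within {0..T}) \<longleftrightarrow>
      ((\<lambda>s. v x s) has_vector_derivative d) (at t within {0..T})" if "t \<in> {0..T}" for x t d
    using Suc.prems that by (intro has_vector_derivative_cong_ev) (auto simp: eventually_at_filter)
  have dt: "dt T u x t = dt T v x t" if "t \<in> {0..T}" for x t
    using vd[OF that] by (simp add: dt_def vector_derivative_def)
  have "continuous_on (strip T) (\<lambda>(x, t). u x t) \<longleftrightarrow> continuous_on (strip T) (\<lambda>(x, t). v x t)"
    using Suc.prems by (auto simp: strip_def intro!: continuous_on_cong)
  moreover have "(\<lambda>s. u x s) differentiable (at t within {0..T}) \<longleftrightarrow>
      (\<lambda>s. v x s) differentiable (at t within {0..T})" if "t \<in> {0..T}" for x t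
    using vd[OF that] by (metis vector_derivative_works has_vector_derivative_def differentiableI_vector)
  ultimately show ?case
    using Suc.IH[of "dx u" "dx v"] Suc.IH[of "dt T u" "dt T v"] dx dt Suc.prems by auto
qed

lemma dt_eq:
  assumes "0 < T" "t \<in> {0..T}" "((\<lambda>s. u x s) has_real_derivative d) (at t within {0..T})"
  shows "dt T u x t = d"
  unfolding dt_def using assms
  by (intro vector_derivative_within_closed_interval)
    (auto simp: has_real_derivative_iff_has_vector_derivative)

text \<open>Any functions that agree on the strip with the partial derivatives may be used to verify
  membership of the next class; the operators \<open>dx\<close> and \<open>dt\<close> need not be computed elsewhere.\<close>
lemma Ck_strip_SucI:
  assumes "0 < T" "continuous_on (strip T) (case_prod u)"
    and "\<And>x t. t \<in> {0..T} \<Longrightarrow> ((\<lambda>y. u y t) has_real_derivative v x t) (at x)"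
    and "\<And>x t. t \<in> {0..T} \<Longrightarrow> ((\<lambda>s. u x s) has_real_derivative w x t) (at t within {0..T})"
    and "Ck_strip k T v" "Ck_strip k T w"
  shows "Ck_strip (Suc k) T u"
proof -
  have "dx u x t = v x t" if "t \<in> {0..T}" for x t
    using assms(3)[OF that] by (simp add: dx_def DERIV_imp_deriv)
  moreover have "dt T u x t = w x t" if "t \<in> {0..T}" for x t
    using assms(4)[OF that] assms(1) that by (intro dt_eq)
  ultimately have "Ck_strip k T (dx u)" "Ck_strip k T (dt T u)"
    using assms(5,6) Ck_strip_cong[of T "dx u" v k] Ck_strip_cong[of T "dt T u" w k] by auto
  then show ?thesis
    using assms(2-4) unfolding Ck_strip.simps real_differentiable_def by blast
qed

text \<open>Write \<open>A\<close> and \<open>B\<close> for the two transported quantities. Then \<open>U = (A + B) / 2\<close> and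
  \<open>V = (A - B) / 2\<close> satisfy \<open>V\<^sub>t = U\<^sub>x\<close> and \<open>U\<^sub>t = V\<^sub>x + H\<close>. By the first identity the time integral \<open>u\<close>
  of \<open>U\<close> has \<open>u\<^sub>x = V\<close>, by the second it solves the wave equation, and \<open>U\<close> and \<open>V\<close> are both of class
  \<open>C\<^sup>1\<close>. One spatial derivative of \<open>H\<close> suffices, since a time derivative of \<open>A\<close> or \<open>B\<close> can be traded
  for a spatial one by the transport equation.\<close>
lemma wave_potential:
  assumes T: "0 < T"
    and \<phi>: "\<And>y. (\<phi> has_real_derivative 1/2 * (\<alpha> y - \<beta> y)) (at y)"
    and \<alpha>: "\<And>y. (\<alpha> has_real_derivative \<alpha>' y) (at y)" "continuous_on UNIV \<alpha>'"
    and \<beta>: "\<And>y. (\<beta> has_real_derivative \<beta>' y) (at y)" "continuous_on UNIV \<beta>'"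
    and H: "continuous_on (strip T) (case_prod H)" "continuous_on (strip T) (case_prod H')"
      "\<And>x t. t \<in> {0..T} \<Longrightarrow> ((\<lambda>y. H y t) has_real_derivative H' x t) (at x)"
  defines "u \<equiv> \<lambda>x t. \<phi> x + ray_int 0 (wave \<alpha> \<beta> H) x t"
  shows "Ck_strip 2 T u"
    and "\<And>x t. t \<in> {0..T} \<Longrightarrow> dt T u x t = wave \<alpha> \<beta> H x t"
    and "\<And>x t. t \<in> {0..T} \<Longrightarrow> dt T (dt T u) x t - dx (dx u) x t = H x t"
proof -
  define U where "U = wave \<alpha> \<beta> H"
  define V where "V x t = 1/2 * (transport (- 1) \<alpha> H x t - transport 1 \<beta> H x t)" for x t
  define P where "P = transport (- 1) \<alpha>' H'"
  define Q where "Q = transport 1 \<beta>' H'"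
  define W where "W x t = 1/2 * (P x t + Q x t)" for x t
  define Z where "Z x t = 1/2 * (P x t - Q x t)" for x t
  have c: "continuous_on UNIV \<alpha>" "continuous_on UNIV \<beta>" "continuous_on UNIV \<phi>"
    by (rule DERIV_continuous_on, rule has_field_derivative_at_within, rule \<alpha> \<beta> \<phi>)+
  have A: "((\<lambda>y. transport (- 1) \<alpha> H y t) has_real_derivative P x t) (at x)"
      "((\<lambda>s. transport (- 1) \<alpha> H x s) has_real_derivative H x t + P x t) (at t within {0..T})"
    and B: "((\<lambda>y. transport 1 \<beta> H y t) has_real_derivative Q x t) (at x)"
      "((\<lambda>s. transport 1 \<beta> H x s) has_real_derivative H x t - Q x t) (at t within {0..T})"
    if t: "t \<in> {0..T}" for x t
    using transport_has_derivative_space[OF \<alpha>(1) H t, of "- 1" x]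
      transport_has_derivative_time[OF \<alpha>(1) H t, of "- 1" x]
      transport_has_derivative_space[OF \<beta>(1) H t, of 1 x]
      transport_has_derivative_time[OF \<beta>(1) H t, of 1 x]
    by (simp_all add: P_def Q_def)
  have cPQ: "continuous_on (strip T) (case_prod P)" "continuous_on (strip T) (case_prod Q)"
    unfolding P_def Q_def by (intro continuous_on_transport \<alpha> \<beta> H)+
  have cW: "continuous_on (strip T) (case_prod W)"
    using continuous_on_mult_left[OF continuous_on_add[OF cPQ], of "1/2"]
    by (simp add: W_def case_prod_beta')
  have cZ: "continuous_on (strip T) (case_prod Z)"
    using continuous_on_mult_left[OF continuous_on_diff[OF cPQ], of "1/2"]
    by (simp add: Z_def case_prod_beta')
  have cHZ: "continuous_on (strip T) (case_prod (\<lambda>x t. H x t + Z x t))"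
    using continuous_on_add[OF H(1) cZ] by (simp add: case_prod_beta')
  have cU: "continuous_on (strip T) (case_prod U)"
    unfolding U_def by (intro continuous_on_wave c H)
  have cV: "continuous_on (strip T) (case_prod V)"
    using continuous_on_mult_left[OF continuous_on_diff[OF
        continuous_on_transport[OF c(1) H(1)] continuous_on_transport[OF c(2) H(1)]], of "1/2" "-1" 1]
    by (simp add: V_def case_prod_beta')
  have Ux: "((\<lambda>y. U y t) has_real_derivative W x t) (at x)"
    and Ut: "((\<lambda>s. U x s) has_real_derivative H x t + Z x t) (at t within {0..T})"
    and Vx: "((\<lambda>y. V y t) has_real_derivative Z x t) (at x)"
    and Vt: "((\<lambda>s. V x s) has_real_derivative W x t) (at t within {0..T})"
    if "t \<in> {0..T}" for x t
    unfolding U_def wave_def V_def W_def Z_def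
    using DERIV_cmult[OF DERIV_add[OF A(1)[OF that, of x] B(1)[OF that, of x]], of "1/2"]
      DERIV_cmult[OF DERIV_add[OF A(2)[OF that, of x] B(2)[OF that, of x]], of "1/2"]
      DERIV_cmult[OF DERIV_diff[OF A(1)[OF that, of x] B(1)[OF that, of x]], of "1/2"]
      DERIV_cmult[OF DERIV_diff[OF A(2)[OF that, of x] B(2)[OF that, of x]], of "1/2"]
    by (simp_all add: field_simps)
  have ux: "((\<lambda>y. u y t) has_real_derivative V x t) (at x)" if t: "t \<in> {0..T}" for x t
  proof -
    \<comment> \<open>Differentiation under the time integral leaves an integral of \<open>U\<^sub>x\<close>, which is merely
      continuous. Since \<open>U\<^sub>x = V\<^sub>t\<close>, that integral is \<open>V\<close> up to its initial value.\<close>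
    have "((\<lambda>s. W x s) has_integral V x t - V x 0) {0..t}"
      using t by (intro fundamental_theorem_of_calculus)
        (auto simp: has_real_derivative_iff_has_vector_derivative[symmetric]
          intro: DERIV_subset[OF Vt])
    then have "ray_int 0 W x t = V x t - 1/2 * (\<alpha> x - \<beta> x)"
      by (auto simp: ray_int_eq integral_unique V_def transport_def)
    moreover have "((\<lambda>y. u y t) has_real_derivative 1/2 * (\<alpha> x - \<beta> x) + ray_int 0 W x t) (at x)"
      unfolding u_def U_def[symmetric]
      by (intro DERIV_add \<phi> ray_int_has_derivative_space[OF cU cW Ux t])
    ultimately show ?thesis by simp
  qed
  have ut: "((\<lambda>s. u x s) has_real_derivative U x t) (at t within {0..T})" if "t \<in> {0..T}" for x t
    unfolding u_def U_def[symmetric]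
    using DERIV_add[OF DERIV_const ray_int_has_derivative_time[OF cU cW Ux that], of "\<phi> x" 0 x]
    by simp
  have "continuous_on (strip T) (\<lambda>z. \<phi> (fst z) + case_prod (ray_int 0 U) z)"
    by (intro continuous_intros continuous_on_compose2[OF c(3)] continuous_on_ray_int[OF cU]) auto
  then have cu: "continuous_on (strip T) (case_prod u)"
    by (simp add: u_def U_def case_prod_beta')
  have "Ck_strip (Suc 0) T U" "Ck_strip (Suc 0) T V"
    by (rule Ck_strip_SucI[OF T cU Ux Ut] Ck_strip_SucI[OF T cV Vx Vt];
        simp add: cW cZ cHZ)+
  then have "Ck_strip (Suc (Suc 0)) T u"
    using ux ut cu T by (intro Ck_strip_SucI[of T u V U])
  then show "Ck_strip 2 T u" by (simp add: numeral_2_eq_2)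
  show "dt T u x t = wave \<alpha> \<beta> H x t" if "t \<in> {0..T}" for x t
    using dt_eq[OF T that ut[OF that]] by (simp add: U_def)
  then have dtu: "dt T u x t = U x t" if "t \<in> {0..T}" for x t
    using that by (simp add: U_def)
  show "dt T (dt T u) x t - dx (dx u) x t = H x t" if t: "t \<in> {0..T}" for x t
  proof -
    have "((\<lambda>s. dt T u x s) has_real_derivative H x t + Z x t) (at t within {0..T})"
      using Ut[OF t] has_derivative_transform[OF t dtu] by (simp add: has_field_derivative_def)
    then have "dt T (dt T u) x t = H x t + Z x t"
      by (intro dt_eq T t)
    moreover have "dx u y t = V y t" for y
      using ux[OF t] by (simp add: dx_def DERIV_imp_deriv)
    then have "dx (dx u) x t = Z x t"
      using Vx[OF t] by (simp add: dx_def[of "dx u"] DERIV_imp_deriv)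
    ultimately show ?thesis by simp
  qed
qed

section \<open>The weight and its integral along a ray\<close>

definition wt :: "real \<Rightarrow> real \<Rightarrow> real" where
  "wt a y = 1 / (1 + y\<^sup>2) powr ((1 + a) / 2)"

definition wt' :: "real \<Rightarrow> real \<Rightarrow> real" where
  "wt' a y = - ((1 + a) * y / (1 + y\<^sup>2)) * wt a y"

lemma one_plus_square_pos [simp]: "0 < 1 + (y::real)\<^sup>2"
  by (simp add: add_pos_nonneg)

lemma wt_pos: "0 < wt a y"
  by (simp add: wt_def powr_def) (metis one_plus_square_pos less_irrefl)

lemma wt_eq_powr: "wt a y = (1 + y\<^sup>2) powr (- ((1 + a) / 2))"
  by (simp add: wt_def powr_minus_divide)

lemma wt_has_derivative: "(wt a has_real_derivative wt' a y) (at y)"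
proof -
  have "((\<lambda>y. (1 + y\<^sup>2) powr (- ((1 + a) / 2))) has_real_derivative
      - ((1 + a) / 2) * (1 + y\<^sup>2) powr (- ((1 + a) / 2) - 1) * (2 * y)) (at y)"
    by (rule DERIV_chain2[OF has_real_derivative_powr]) (auto intro!: derivative_eq_intros)
  moreover have "(1 + y\<^sup>2) powr (- ((1 + a) / 2) - 1) = wt a y / (1 + y\<^sup>2)"
    using one_plus_square_pos[of y] by (simp only: wt_eq_powr powr_diff) simp
  moreover have "- ((1 + a) / 2) * (w / c) * (2 * y) = - ((1 + a) * y / c) * w" for w c :: real
    by (cases "c = 0") (auto simp: field_simps)
  moreover have "(\<lambda>y. (1 + y\<^sup>2) powr (- ((1 + a) / 2))) = wt a"
    by (simp add: wt_eq_powr fun_eq_iff)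
  ultimately show ?thesis
    by (simp only: wt'_def)
qed

text \<open>The derivative of the weight is dominated by the weight itself, so the term it contributes to
  the differentiated equation obeys the same integral bounds.\<close>
lemma wt'_bound: "\<bar>wt' a y\<bar> \<le> \<bar>1 + a\<bar> * wt a y"
proof -
  have "0 \<le> (\<bar>y\<bar> - 1/2)\<^sup>2" by simp
  then have "\<bar>y\<bar> \<le> 1 + y\<^sup>2" by (simp add: power2_eq_square algebra_simps)
  then have "\<bar>y\<bar> / (1 + y\<^sup>2) \<le> 1" by (simp add: divide_le_eq)
  then have "\<bar>1 + a\<bar> * (\<bar>y\<bar> / (1 + y\<^sup>2)) * wt a y \<le> \<bar>1 + a\<bar> * 1 * wt a y"
    using wt_pos[of a y] by (intro mult_right_mono mult_left_mono) auto
  moreover have "\<bar>1 + y\<^sup>2\<bar> = 1 + y\<^sup>2" "\<bar>wt a y\<bar> = wt a y"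
    using wt_pos[of a y] by auto
  ultimately show ?thesis by (simp add: wt'_def abs_mult)
qed

lemma continuous_on_wt: "continuous_on S (wt a)"
  using wt_has_derivative by (meson DERIV_isCont continuous_at_imp_continuous_on)

lemma continuous_on_wt': "continuous_on S (wt' a)"
  unfolding wt'_def[abs_def]
  by (intro continuous_intros continuous_on_wt) (metis one_plus_square_pos less_irrefl)

text \<open>For \<open>\<rho> = T + R\<close> this is the quantity called \<open>I(T)\<close> at the beginning.\<close>
definition wt_mass :: "real \<Rightarrow> real \<Rightarrow> real" where
  "wt_mass a \<rho> = integral {-\<rho>..\<rho>} (wt a)"

lemma wt_mass_nonneg: "0 \<le> wt_mass a \<rho>"
  unfolding wt_mass_def
  by (intro integral_nonneg integrable_continuous_real continuous_on_wt)
    (simp add: less_imp_le wt_pos)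

text \<open>A characteristic of speed \<open>\<plusminus>1\<close> meets the region \<open>\<bar>y\<bar> \<le> \<rho>\<close> in a single time interval, on which
  position is a unit-speed parameter. The time integral is therefore part of the integral over
  \<open>{-\<rho>..\<rho>}\<close>, however long the ray is.\<close>
lemma wt_integral_along_ray:
  fixes \<sigma> \<xi> \<rho> a t :: real
  assumes "\<sigma> \<in> {- 1, 1}"
  defines "k \<equiv> \<lambda>s. if \<bar>\<xi> + \<sigma> * s\<bar> \<le> \<rho> then wt a (\<xi> + \<sigma> * s) else 0"
  shows "k integrable_on {0..t}" "integral {0..t} k \<le> wt_mass a \<rho>"
proof -
  define J where "J = (if \<sigma> = 1 then {-\<rho> - \<xi>..\<rho> - \<xi>} else {\<xi> - \<rho>..\<xi> + \<rho>})"
  define h where "h s = wt a (\<xi> + \<sigma> * s)" for s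
  have k: "k = (\<lambda>s. if s \<in> J then h s else 0)"
    using assms(1) by (auto simp: k_def J_def h_def fun_eq_iff)
  have cont: "continuous_on S h" for S
    unfolding h_def by (rule continuous_on_compose2[OF continuous_on_wt]) (auto intro!: continuous_intros)
  have "\<exists>b c. J \<inter> {0..t} = {b..c}"
    unfolding J_def by (cases "\<sigma> = 1") (simp_all add: Int_atLeastAtMost, blast+)
  then have int: "h integrable_on J \<inter> {0..t}"
    using integrable_continuous_real[OF cont] by force
  have intJ: "h integrable_on J"
    unfolding J_def by (auto intro: integrable_continuous_real[OF cont])
  show "k integrable_on {0..t}"
    using int by (simp add: k integrable_restrict_Int)
  have "integral {0..t} k = integral (J \<inter> {0..t}) h"
    by (simp add: k integral_restrict_Int)
  also have "\<dots> \<le> integral J h"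
    by (intro integral_subset_le int intJ) (auto simp: h_def less_imp_le wt_pos)
  also have "\<dots> = wt_mass a \<rho>"
  proof -
    have right: "integral {-\<rho> - c..\<rho> - c} (\<lambda>s. wt a (c + s)) = wt_mass a \<rho>" for c
      using integral_shift_real_ivl[of "-\<rho>" c \<rho> "wt a"] by (simp add: wt_mass_def add.commute)
    show ?thesis
    proof (cases "\<sigma> = 1")
      case True
      then show ?thesis using right[of \<xi>] by (simp add: J_def h_def[abs_def])
    next
      case False
      with assms(1) have "\<sigma> = - 1" by auto
      then show ?thesis
        using Henstock_Kurzweil_Integration.integral_reflect_real[of "\<rho> - \<xi>" "-\<rho> - \<xi>" "\<lambda>s. wt a (\<xi> + s)"] right[of \<xi>]
        by (simp add: J_def h_def[abs_def])
    qed
  qed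
  finally show "integral {0..t} k \<le> wt_mass a \<rho>" .
qed

lemma ray_int_bound:
  assumes H: "continuous_on (strip T) (case_prod H)" and \<sigma>: "\<sigma> \<in> {- 1, 1}"
    and bd: "\<And>y s. s \<in> {0..T} \<Longrightarrow> \<bar>H y s\<bar> \<le> m * wt a y"
    and van: "\<And>y s. s \<in> {0..T} \<Longrightarrow> \<rho> < \<bar>y\<bar> \<Longrightarrow> H y s = 0"
    and m: "0 \<le> m" and t: "t \<in> {0..T}"
  shows "\<bar>ray_int \<sigma> H x t\<bar> \<le> m * wt_mass a \<rho>"
proof -
  define \<xi> where "\<xi> = x - \<sigma> * t"
  define k where "k s = (if \<bar>\<xi> + \<sigma> * s\<bar> \<le> \<rho> then wt a (\<xi> + \<sigma> * s) else 0)" for s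
  note k = wt_integral_along_ray[OF \<sigma>, where \<xi> = \<xi> and \<rho> = \<rho> and a = a and t = t, folded k_def]
  have "norm (ray_int \<sigma> H x t) \<le> integral {0..t} (\<lambda>s. m * k s)"
    unfolding ray_int_eq \<xi>_def[symmetric]
  proof (rule integral_norm_bound_integral)
    show "(\<lambda>s. H (\<xi> + \<sigma> * s) s) integrable_on {0..t}"
      using char_int_integrable[OF H] t by auto
    show "(\<lambda>s. m * k s) integrable_on {0..t}"
      using k(1) by (rule integrable_on_mult_right)
    show "norm (H (\<xi> + \<sigma> * s) s) \<le> m * k s" if "s \<in> {0..t}" for s
      using bd[of s "\<xi> + \<sigma> * s"] van[of s "\<xi> + \<sigma> * s"] that t by (auto simp: k_def)
  qed
  also have "\<dots> \<le> m * wt_mass a \<rho>"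
    using k(2) m by (simp add: mult_left_mono)
  finally show ?thesis by simp
qed

lemma wave_bound:
  assumes "continuous_on (strip T) (case_prod H)"
    and "\<And>y s. s \<in> {0..T} \<Longrightarrow> \<bar>H y s\<bar> \<le> m * wt a y"
    and "\<And>y s. s \<in> {0..T} \<Longrightarrow> \<rho> < \<bar>y\<bar> \<Longrightarrow> H y s = 0"
    and "0 \<le> m" "t \<in> {0..T}"
    and "\<And>y. \<bar>\<alpha> y\<bar> \<le> N" "\<And>y. \<bar>\<beta> y\<bar> \<le> N"
  shows "\<bar>wave \<alpha> \<beta> H x t\<bar> \<le> N + m * wt_mass a \<rho>"
proof -
  have "\<bar>ray_int (- 1) H x t\<bar> \<le> m * wt_mass a \<rho>" "\<bar>ray_int 1 H x t\<bar> \<le> m * wt_mass a \<rho>"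
    using assms by (auto intro!: ray_int_bound)
  then show ?thesis
    using assms(6)[of "x + t"] assms(7)[of "x - t"] by (simp add: wave_def transport_def)
qed

lemma wave_diff_bound:
  assumes "continuous_on (strip T) (case_prod G)" "continuous_on (strip T) (case_prod H)"
    and "\<And>y s. s \<in> {0..T} \<Longrightarrow> \<bar>G y s - H y s\<bar> \<le> m * wt a y"
    and "\<And>y s. s \<in> {0..T} \<Longrightarrow> \<rho> < \<bar>y\<bar> \<Longrightarrow> G y s = 0"
    and "\<And>y s. s \<in> {0..T} \<Longrightarrow> \<rho> < \<bar>y\<bar> \<Longrightarrow> H y s = 0"
    and "0 \<le> m" and t: "t \<in> {0..T}"
  shows "\<bar>wave \<alpha> \<beta> G x t - wave \<alpha> \<beta> H x t\<bar> \<le> m * wt_mass a \<rho>"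
proof -
  define D where "D y s = G y s - H y s" for y s
  have "ray_int \<sigma> D x t = ray_int \<sigma> G x t - ray_int \<sigma> H x t" for \<sigma>
    unfolding ray_int_eq D_def using t
    by (intro integral_diff char_int_integrable[OF assms(1)] char_int_integrable[OF assms(2)]) auto
  then have "wave \<alpha> \<beta> G x t - wave \<alpha> \<beta> H x t = wave (\<lambda>_. 0) (\<lambda>_. 0) D x t"
    by (simp only: wave_def transport_def) (simp add: field_simps)
  moreover have "continuous_on (strip T) (case_prod D)"
    using continuous_on_diff[OF assms(1,2)] by (simp add: D_def case_prod_beta')
  then have "\<bar>wave (\<lambda>_. 0) (\<lambda>_. 0) D x t\<bar> \<le> 0 + m * wt_mass a \<rho>"
    by (rule wave_bound) (use assms in \<open>auto simp: D_def\<close>)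
  ultimately show ?thesis by simp
qed

text \<open>Finite speed of propagation: a backward ray from a point outside the cone \<open>\<bar>x\<bar> \<le> t + R\<close> never
  enters the cone.\<close>
lemma wave_vanishes:
  assumes "\<And>y. R < \<bar>y\<bar> \<Longrightarrow> \<alpha> y = 0" "\<And>y. R < \<bar>y\<bar> \<Longrightarrow> \<beta> y = 0"
    and H: "\<And>y s. s \<in> {0..T} \<Longrightarrow> s + R < \<bar>y\<bar> \<Longrightarrow> H y s = 0"
    and x: "t + R < \<bar>x\<bar>" and t: "t \<in> {0..T}"
  shows "wave \<alpha> \<beta> H x t = 0"
proof -
  have "ray_int \<sigma> H x t = 0" if "\<sigma> \<in> {- 1, 1}" for \<sigma>
  proof -
    have "integral {0..t} (\<lambda>s. H (x - \<sigma> * t + \<sigma> * s) s) = integral {0..t} (\<lambda>s. 0)"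
      using that x t by (intro integral_cong H) auto
    then show ?thesis by (simp add: ray_int_eq)
  qed
  moreover have "\<alpha> (x + t) = 0" "\<beta> (x - t) = 0"
    using x t by (auto intro!: assms)
  ultimately show ?thesis by (simp add: wave_def transport_def)
qed

section \<open>Lipschitz bounds and derivatives of power functions\<close>

lemma powr_Lipschitz:
  fixes q x y m :: real
  assumes q: "1 \<le> q" and x: "x \<in> {0..m}" and y: "y \<in> {0..m}"
  shows "\<bar>x powr q - y powr q\<bar> \<le> q * m powr (q - 1) * \<bar>x - y\<bar>"
proof -
  have ordered: "x powr q - y powr q \<le> q * m powr (q - 1) * (x - y)"
    if bounds: "0 \<le> y" "y < x" "x \<le> m" for x y :: real
  proof -
    have "continuous_on {y..x} (\<lambda>z. z powr q)"
      using q that by (intro continuous_on_powr' continuous_intros) auto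
    moreover have "((\<lambda>z. z powr q) has_derivative (*) (q * z powr (q - 1))) (at z)" if "y < z" for z
      using has_real_derivative_powr[of z q] that \<open>0 \<le> y\<close> by (simp add: has_field_derivative_def)
    ultimately obtain z where z: "y < z" "z < x"
      "x powr q - y powr q = q * z powr (q - 1) * (x - y)"
      using mvt[of y x "\<lambda>z. z powr q" "\<lambda>z. (*) (q * z powr (q - 1))"] bounds(2) by blast
    have "z powr (q - 1) \<le> m powr (q - 1)"
      using z bounds q by (intro powr_mono2) auto
    then show ?thesis
      using z(3) q bounds by (simp add: mult_left_mono mult_right_mono)
  qed
  have mono: "u powr q \<le> v powr q" if "0 \<le> u" "u \<le> v" for u v :: real
    using that q by (intro powr_mono2) auto
  consider "x = y" | "y < x" | "x < y" by linarith
  then show ?thesis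
    using ordered[of y x] ordered[of x y] mono[of x y] mono[of y x] x y
    by cases (auto simp: abs_if)
qed

text \<open>The odd power; \<open>p * spow (p - 1) x\<close> is the derivative of \<open>\<bar>x\<bar>\<^sup>p\<close>.\<close>
definition spow :: "real \<Rightarrow> real \<Rightarrow> real" where
  "spow q x = sgn x * \<bar>x\<bar> powr q"

lemma abs_powr_Lipschitz:
  fixes q x y m :: real
  assumes "1 \<le> q" "\<bar>x\<bar> \<le> m" "\<bar>y\<bar> \<le> m"
  shows "\<bar>\<bar>x\<bar> powr q - \<bar>y\<bar> powr q\<bar> \<le> q * m powr (q - 1) * \<bar>x - y\<bar>"
proof -
  have "\<bar>\<bar>x\<bar> powr q - \<bar>y\<bar> powr q\<bar> \<le> q * m powr (q - 1) * \<bar>\<bar>x\<bar> - \<bar>y\<bar>\<bar>"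
    using assms by (intro powr_Lipschitz) auto
  also have "\<dots> \<le> q * m powr (q - 1) * \<bar>x - y\<bar>"
    using assms by (intro mult_left_mono) auto
  finally show ?thesis .
qed

lemma abs_spow: "\<bar>spow q x\<bar> = \<bar>x\<bar> powr q"
  by (simp add: spow_def abs_mult abs_sgn_eq)

text \<open>For arguments of equal sign this is the bound for \<open>\<bar>x\<bar>\<^sup>q\<close>. For opposite signs the distance is
  \<open>\<bar>x\<bar> + \<bar>y\<bar>\<close>, and the bound is applied to each argument against \<open>0\<close>. The condition \<open>q \<ge> 1\<close> is
  the source of the requirement \<open>p \<ge> 2\<close> for classical solutions.\<close>
lemma spow_Lipschitz:
  assumes q: "1 \<le> q" and x: "\<bar>x\<bar> \<le> m" and y: "\<bar>y\<bar> \<le> m"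
  shows "\<bar>spow q x - spow q y\<bar> \<le> q * m powr (q - 1) * \<bar>x - y\<bar>"
proof (cases "0 \<le> x * y")
  case True
  then have "\<bar>spow q x - spow q y\<bar> = \<bar>\<bar>x\<bar> powr q - \<bar>y\<bar> powr q\<bar>"
    by (auto simp: spow_def sgn_if zero_le_mult_iff)
  then show ?thesis using abs_powr_Lipschitz[OF assms] by simp
next
  case False
  then have "\<bar>x - y\<bar> = \<bar>x\<bar> + \<bar>y\<bar>"
    by (auto simp: zero_le_mult_iff abs_if)
  moreover have "\<bar>z\<bar> powr q \<le> q * m powr (q - 1) * \<bar>z\<bar>" if "\<bar>z\<bar> \<le> m" for z
    using powr_Lipschitz[OF q, of "\<bar>z\<bar>" m 0] that by simp
  from this[OF x] this[OF y] have "\<bar>spow q x\<bar> + \<bar>spow q y\<bar> \<le> q * m powr (q - 1) * (\<bar>x\<bar> + \<bar>y\<bar>)"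
    by (simp add: abs_spow distrib_left)
  ultimately show ?thesis by (smt (verit, best))
qed

lemma abs_powr_has_derivative:
  assumes "1 < p"
  shows "((\<lambda>x. \<bar>x\<bar> powr p) has_real_derivative p * spow (p - 1) x) (at x)"
proof (cases "x = 0")
  case True
  \<comment> \<open>At the origin the difference quotient is itself an odd power, with exponent \<open>p - 1 > 0\<close>.\<close>
  have "((\<lambda>h. \<bar>h\<bar> powr (p - 1)) \<longlongrightarrow> 0) (at (0::real))"
    using assms by (intro tendsto_eq_intros) (auto intro!: tendsto_eq_intros)
  then have "((\<lambda>h. spow (p - 1) h) \<longlongrightarrow> 0) (at 0)"
    by (intro tendsto_rabs_zero_cancel[of "spow (p - 1)"]) (simp add: abs_spow[abs_def])
  moreover have "(\<bar>h\<bar> powr p) / h = spow (p - 1) h" if "h \<noteq> 0" for h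
    using that by (auto simp: spow_def powr_diff sgn_if)
  ultimately have "((\<lambda>h. (\<bar>h\<bar> powr p) / h) \<longlongrightarrow> 0) (at 0)"
    by (auto elim!: Lim_transform_eventually simp: eventually_at_filter)
  then show ?thesis
    using True by (simp add: has_field_derivative_iff spow_def)
next
  case False
  define S where "S = (if 0 < x then {0::real<..} else {..<0})"
  have "(abs has_real_derivative sgn x) (at x)"
    by (rule has_field_derivative_transform_within_open[of "\<lambda>z. sgn x * z" _ _ S])
      (use False in \<open>auto simp: S_def sgn_if intro!: derivative_eq_intros split: if_splits\<close>)
  then have "((\<lambda>x. \<bar>x\<bar> powr p) has_real_derivative p * \<bar>x\<bar> powr (p - 1) * sgn x) (at x)"
    using False by (intro DERIV_chain2[OF has_real_derivative_powr]) auto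
  then show ?thesis by (simp add: spow_def mult_ac)
qed

lemma continuous_on_spow:
  assumes "0 < q" "continuous_on S u"
  shows "continuous_on S (\<lambda>x. spow q (u x))"
proof -
  have "spow q x = max x 0 powr q - max (- x) 0 powr q" for x
    by (auto simp: spow_def sgn_if max_def)
  moreover have "continuous_on S (\<lambda>x. max (u x) 0 powr q - max (- u x) 0 powr q)"
    using assms by (intro continuous_intros continuous_on_powr') auto
  ultimately show ?thesis by simp
qed

section \<open>Picard iteration\<close>

lemma geometric_uniform_limit:
  fixes F :: "nat \<Rightarrow> 'a \<Rightarrow> real"
  assumes "\<And>n z. z \<in> S \<Longrightarrow> \<bar>F (Suc n) z - F n z\<bar> \<le> D * q ^ n" "0 \<le> q" "q < 1"
  obtains L where "uniform_limit S F L sequentially"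
proof -
  have "uniform_limit S (\<lambda>n z. \<Sum>i<n. F (Suc i) z - F i z)
      (\<lambda>z. \<Sum>i. F (Suc i) z - F i z) sequentially"
    by (rule Weierstrass_m_test[where M = "\<lambda>n. D * q ^ n"])
      (use assms in \<open>auto intro!: summable_mult summable_geometric\<close>)
  moreover have "(\<Sum>i<n. F (Suc i) z - F i z) + F 0 z = F n z" for n z
    using sum_lessThan_telescope[of "\<lambda>i. F i z" n] by simp
  ultimately have "uniform_limit S F (\<lambda>z. (\<Sum>i. F (Suc i) z - F i z) + F 0 z) sequentially"
    using uniform_limit_add[OF _ uniform_limit_const[where c = "F 0"]] by fastforce
  then show ?thesis by (rule that)
qed

definition source :: "real \<Rightarrow> real \<Rightarrow> (real \<Rightarrow> real \<Rightarrow> real) \<Rightarrow> real \<Rightarrow> real \<Rightarrow> real" where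
  "source p a v y s = \<bar>v y s\<bar> powr p * wt a y"

text \<open>The \<open>x\<close>-derivative of \<open>source p a v\<close> when \<open>z\<close> is the \<open>x\<close>-derivative of \<open>v\<close>. Treating \<open>z\<close> as an
  independent argument makes it possible to iterate on the derivative, for which the expression is
  affine.\<close>
definition source_dx ::
  "real \<Rightarrow> real \<Rightarrow> (real \<Rightarrow> real \<Rightarrow> real) \<Rightarrow> (real \<Rightarrow> real \<Rightarrow> real) \<Rightarrow> real \<Rightarrow> real \<Rightarrow> real" where
  "source_dx p a v z y s = p * spow (p - 1) (v y s) * z y s * wt a y + \<bar>v y s\<bar> powr p * wt' a y"

lemma continuous_on_source:
  assumes "1 < p" "continuous_on (strip T) (case_prod v)"
  shows "continuous_on (strip T) (case_prod (source p a v))"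
proof -
  have "continuous_on (strip T) (\<lambda>w. \<bar>case_prod v w\<bar> powr p * wt a (fst w))"
    using assms by (intro continuous_intros continuous_on_powr'
        continuous_on_compose2[OF continuous_on_wt[of UNIV]]) auto
  then show ?thesis by (simp add: source_def case_prod_beta')
qed

lemma continuous_on_source_dx:
  assumes "1 < p" "continuous_on (strip T) (case_prod v)" "continuous_on (strip T) (case_prod z)"
  shows "continuous_on (strip T) (case_prod (source_dx p a v z))"
proof -
  have "continuous_on (strip T) (\<lambda>w. p * spow (p - 1) (case_prod v w) * case_prod z w * wt a (fst w)
      + \<bar>case_prod v w\<bar> powr p * wt' a (fst w))"
    using assms by (intro continuous_intros continuous_on_powr' continuous_on_spow
        continuous_on_compose2[OF continuous_on_wt[of UNIV]]
        continuous_on_compose2[OF continuous_on_wt'[of UNIV]]) auto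
  then show ?thesis by (simp add: source_dx_def case_prod_beta')
qed

lemma source_has_derivative:
  assumes "1 < p" "((\<lambda>y. v y s) has_real_derivative z y s) (at y)"
  shows "((\<lambda>y. source p a v y s) has_real_derivative source_dx p a v z y s) (at y)"
  using DERIV_mult[OF DERIV_chain2[OF abs_powr_has_derivative[OF assms(1)] assms(2)]
      wt_has_derivative[of a y]]
  by (simp add: source_def source_dx_def algebra_simps)

text \<open>The last assumption is the contraction condition: on functions bounded by \<open>2 M\<close> the source is
  Lipschitz with constant \<open>p (2 M)\<^bsup>p - 1\<^esup>\<close> times the weight.\<close>
locale small_data =
  fixes p a R T M :: real and \<alpha> \<beta> :: "real \<Rightarrow> real"
  assumes p: "1 < p" and T: "0 \<le> T" and M: "0 < M"
    and cont: "continuous_on UNIV \<alpha>" "continuous_on UNIV \<beta>"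
    and bound: "\<And>y. \<bar>\<alpha> y\<bar> \<le> M" "\<And>y. \<bar>\<beta> y\<bar> \<le> M"
    and vanish: "\<And>y. R < \<bar>y\<bar> \<Longrightarrow> \<alpha> y = 0" "\<And>y. R < \<bar>y\<bar> \<Longrightarrow> \<beta> y = 0"
    and small: "p * (2 * M) powr (p - 1) * wt_mass a (T + R) \<le> 1/2"
begin

text \<open>The bound \<open>2 M\<close> leaves room for the free wave, of size at most \<open>M\<close>, and for a nonlinear
  correction of the same size.\<close>
definition admissible :: "(real \<Rightarrow> real \<Rightarrow> real) \<Rightarrow> bool" where
  "admissible v \<longleftrightarrow> continuous_on (strip T) (case_prod v) \<and>
    (\<forall>x. \<forall>t\<in>{0..T}. \<bar>v x t\<bar> \<le> 2 * M \<and> (t + R < \<bar>x\<bar> \<longrightarrow> v x t = 0))"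

abbreviation solve :: "(real \<Rightarrow> real \<Rightarrow> real) \<Rightarrow> real \<Rightarrow> real \<Rightarrow> real" where
  "solve v \<equiv> wave \<alpha> \<beta> (source p a v)"

lemma source_bound:
  assumes "admissible v" "s \<in> {0..T}"
  shows "\<bar>v y s\<bar> powr p \<le> (2 * M) powr p" "\<bar>source p a v y s\<bar> \<le> (2 * M) powr p * wt a y"
proof -
  show *: "\<bar>v y s\<bar> powr p \<le> (2 * M) powr p"
    using assms p by (auto simp: admissible_def intro!: powr_mono2)
  show "\<bar>source p a v y s\<bar> \<le> (2 * M) powr p * wt a y"
    using mult_right_mono[OF *, of "wt a y"] wt_pos[of a y]
    by (simp add: source_def abs_mult)
qed

lemma mass_bound: "(2 * M) powr p * wt_mass a (T + R) \<le> M"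
proof -
  have "(2 * M) powr p * wt_mass a (T + R) = 2 * M * ((2 * M) powr (p - 1) * wt_mass a (T + R))"
    using M by (simp add: powr_diff)
  also have "(2 * M) powr (p - 1) * wt_mass a (T + R) \<le> p * (2 * M) powr (p - 1) * wt_mass a (T + R)"
    using p wt_mass_nonneg[of a "T + R"] mult_right_mono[of 1 p "(2 * M) powr (p - 1) * wt_mass a (T + R)"]
    by (simp add: mult.assoc)
  also have "\<dots> \<le> 1/2" by (rule small)
  finally show ?thesis using M by simp
qed

lemma admissible_solve:
  assumes "admissible v"
  shows "admissible (solve v)"
proof -
  have v: "continuous_on (strip T) (case_prod v)"
    "\<And>x t. t \<in> {0..T} \<Longrightarrow> t + R < \<bar>x\<bar> \<Longrightarrow> v x t = 0"
    using assms by (auto simp: admissible_def)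
  have c: "continuous_on (strip T) (case_prod (source p a v))"
    by (rule continuous_on_source[OF p v(1)])
  have *: "\<bar>solve v x t\<bar> \<le> M + (2 * M) powr p * wt_mass a (T + R)" if "t \<in> {0..T}" for x t
    by (rule wave_bound[OF c source_bound(2)[OF assms]])
      (use v that bound in \<open>auto simp: source_def\<close>)
  have "\<bar>solve v x t\<bar> \<le> 2 * M" if "t \<in> {0..T}" for x t
    using *[OF that, of x] mass_bound by linarith
  moreover have "solve v x t = 0" if "t \<in> {0..T}" "t + R < \<bar>x\<bar>" for x t
    by (rule wave_vanishes[OF vanish _ that(2,1)]) (auto simp: source_def v)
  ultimately show ?thesis
    using continuous_on_wave[OF cont c] by (simp add: admissible_def)
qed

text \<open>The distance hypothesis is pointwise rather than in terms of a supremum, so that the lemma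
  serves both for successive iterates and for the distance to the limit.\<close>
lemma contraction:
  assumes "admissible u" "admissible v" and d: "\<And>x t. t \<in> {0..T} \<Longrightarrow> \<bar>u x t - v x t\<bar> \<le> d"
    and t: "t \<in> {0..T}"
  shows "\<bar>solve u x t - solve v x t\<bar> \<le> d / 2"
proof -
  define K where "K = p * (2 * M) powr (p - 1)"
  have d0: "0 \<le> d" using d[OF t, of x] by linarith
  have K0: "0 \<le> K" using p by (simp add: K_def)
  have "\<bar>solve u x t - solve v x t\<bar> \<le> (K * d) * wt_mass a (T + R)"
  proof (rule wave_diff_bound)
    fix y s assume s: "s \<in> {0..T}"
    have "\<bar>\<bar>u y s\<bar> powr p - \<bar>v y s\<bar> powr p\<bar> \<le> K * \<bar>u y s - v y s\<bar>"
      unfolding K_def using assms(1,2) s p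
      by (intro abs_powr_Lipschitz) (auto simp: admissible_def)
    also have "\<dots> \<le> K * d"
      using d[OF s] K0 by (rule mult_left_mono)
    finally have "\<bar>\<bar>u y s\<bar> powr p - \<bar>v y s\<bar> powr p\<bar> * wt a y \<le> K * d * wt a y"
      using wt_pos[of a y] by (intro mult_right_mono) auto
    then show "\<bar>source p a u y s - source p a v y s\<bar> \<le> K * d * wt a y"
      using wt_pos[of a y] by (simp add: source_def abs_mult flip: left_diff_distrib)
  qed (use assms d0 K0 p in \<open>auto simp: admissible_def source_def intro!: continuous_on_source\<close>)
  also have "\<dots> = d * (K * wt_mass a (T + R))" by simp
  also have "\<dots> \<le> d * (1/2)"
    using small d0 by (intro mult_left_mono) (auto simp: K_def)
  finally show ?thesis by simp
qed

primrec picard :: "nat \<Rightarrow> real \<Rightarrow> real \<Rightarrow> real" where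
  "picard 0 = (\<lambda>_ _. 0)"
| "picard (Suc n) = solve (picard n)"

lemma admissible_picard: "admissible (picard n)"
proof (induction n)
  case 0
  then show ?case using M by (auto simp: admissible_def case_prod_beta')
qed (simp add: admissible_solve)

lemma picard_step:
  assumes "t \<in> {0..T}"
  shows "\<bar>picard (Suc n) x t - picard n x t\<bar> \<le> 2 * M * (1/2) ^ n"
  using assms
proof (induction n arbitrary: x t)
  case 0
  then show ?case using admissible_picard[of "Suc 0"] by (auto simp: admissible_def)
next
  case (Suc n)
  then show ?case
    using contraction[OF admissible_picard[of "Suc n"] admissible_picard[of n] Suc.IH Suc.prems]
    by simp
qed

text \<open>The limit inherits admissibility from the iterates. It is a fixed point because the contraction
  estimate lets the uniform limit pass through \<open>solve\<close>.\<close>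
lemma picard_limit:
  obtains U where "uniform_limit (strip T) (\<lambda>n. case_prod (picard n)) (case_prod U) sequentially"
    "admissible U" "\<And>x t. t \<in> {0..T} \<Longrightarrow> U x t = solve U x t"
proof -
  obtain L where L: "uniform_limit (strip T) (\<lambda>n. case_prod (picard n)) L sequentially"
    by (rule geometric_uniform_limit[where S = "strip T" and F = "\<lambda>n. case_prod (picard n)"
          and D = "2 * M" and q = "1/2"])
      (use picard_step in \<open>auto simp: strip_def\<close>)
  define U where "U x t = L (x, t)" for x t
  have U: "uniform_limit (strip T) (\<lambda>n. case_prod (picard n)) (case_prod U) sequentially"
    using L by (simp add: U_def[abs_def])
  have lim: "(\<lambda>n. picard n x t) \<longlonglongrightarrow> U x t" if "t \<in> {0..T}" for x t
    using tendsto_uniform_limitI[OF U, of "(x, t)"] that by (simp add: strip_def)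
  have "continuous_on (strip T) (case_prod U)"
    using admissible_picard by (intro uniform_limit_theorem[OF _ U]) (auto simp: admissible_def)
  moreover have "\<bar>U x t\<bar> \<le> 2 * M" if "t \<in> {0..T}" for x t
    using admissible_picard that
    by (intro tendsto_upperbound[OF tendsto_rabs[OF lim[OF that]]]) (auto simp: admissible_def)
  moreover have "U x t = 0" if "t \<in> {0..T}" "t + R < \<bar>x\<bar>" for x t
    using admissible_picard that LIMSEQ_unique[OF lim[OF that(1)], of x 0] by (simp add: admissible_def)
  ultimately have adm: "admissible U" by (simp add: admissible_def)
  have "U x t = solve U x t" if t: "t \<in> {0..T}" for x t
  proof (rule LIMSEQ_unique)
    show "(\<lambda>n. picard (Suc n) x t) \<longlonglongrightarrow> U x t"
      using lim[OF t] by (rule LIMSEQ_Suc)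
    show "(\<lambda>n. picard (Suc n) x t) \<longlonglongrightarrow> solve U x t"
    proof (rule metric_LIMSEQ_I)
      fix e :: real assume "0 < e"
      from uniform_limitD[OF U this]
      obtain n0 where "\<forall>n\<ge>n0. \<forall>z\<in>strip T. dist (case_prod (picard n) z) (case_prod U z) < e"
        by (auto simp: eventually_sequentially)
      then have n0: "\<bar>picard n y s - U y s\<bar> < e" if "n0 \<le> n" "s \<in> {0..T}" for n y s
        using that by (force simp: strip_def dist_real_def)
      have "dist (picard (Suc n) x t) (solve U x t) < e" if "n0 \<le> n" for n
        using contraction[OF admissible_picard[of n] adm less_imp_le[OF n0[OF that]] t, of x] \<open>0 < e\<close>
        by (simp add: dist_real_def)
      then show "\<exists>n0. \<forall>n\<ge>n0. dist (picard (Suc n) x t) (solve U x t) < e" by blast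
    qed
  qed
  with U adm show ?thesis by (rule that)
qed

end

section \<open>Differentiability of the Picard limit\<close>

locale small_data_C1 = small_data +
  fixes N :: real and \<alpha>' \<beta>' :: "real \<Rightarrow> real"
  assumes p2: "2 \<le> p" and N: "0 \<le> N"
    and deriv: "\<And>y. (\<alpha> has_real_derivative \<alpha>' y) (at y)" "\<And>y. (\<beta> has_real_derivative \<beta>' y) (at y)"
    and cont': "continuous_on UNIV \<alpha>'" "continuous_on UNIV \<beta>'"
    and bound': "\<And>y. \<bar>\<alpha>' y\<bar> \<le> N" "\<And>y. \<bar>\<beta>' y\<bar> \<le> N"
begin

abbreviation solve_dx :: "(real \<Rightarrow> real \<Rightarrow> real) \<Rightarrow> (real \<Rightarrow> real \<Rightarrow> real) \<Rightarrow> real \<Rightarrow> real \<Rightarrow> real" where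
  "solve_dx v z \<equiv> wave \<alpha>' \<beta>' (source_dx p a v z)"

primrec picard_dx :: "nat \<Rightarrow> real \<Rightarrow> real \<Rightarrow> real" where
  "picard_dx 0 = (\<lambda>_ _. 0)"
| "picard_dx (Suc n) = solve_dx (picard n) (picard_dx n)"

lemma continuous_on_picard: "continuous_on (strip T) (case_prod (picard n))"
  using admissible_picard by (simp add: admissible_def)

lemma continuous_on_picard_dx: "continuous_on (strip T) (case_prod (picard_dx n))"
proof (induction n)
  case (Suc n)
  then show ?case
    by (simp add: continuous_on_wave continuous_on_source_dx cont' p continuous_on_picard)
qed (simp add: case_prod_beta')

lemma picard_has_derivative:
  assumes "t \<in> {0..T}"
  shows "((\<lambda>y. picard n y t) has_real_derivative picard_dx n x t) (at x)"
  using assms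
proof (induction n arbitrary: x t)
  case (Suc n)
  show ?case
    unfolding picard.simps picard_dx.simps
    by (intro wave_has_derivative_space[OF deriv _ _ _ Suc.prems] source_has_derivative p Suc.IH
        continuous_on_source continuous_on_source_dx continuous_on_picard continuous_on_picard_dx)
qed simp

text \<open>The fixed point of \<open>b \<mapsto> N + b/2 + M \<bar>1 + a\<bar>\<close>, which is how one step changes a bound \<open>b\<close> for the
  derivative: \<open>N\<close> comes from the data, \<open>b/2\<close> from the contraction condition and the last term from the
  derivative of the weight.\<close>
definition slope_bound :: real where
  "slope_bound = 2 * (N + M * \<bar>1 + a\<bar>)"

lemma slope_bound_nonneg: "0 \<le> slope_bound"
  using N M by (simp add: slope_bound_def)

lemma picard_dx_bound:
  assumes "t \<in> {0..T}"
  shows "\<bar>picard_dx n x t\<bar> \<le> slope_bound"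
  using assms
proof (induction n arbitrary: x t)
  case 0
  then show ?case by (simp add: slope_bound_nonneg)
next
  case (Suc n)
  let ?v = "picard n" and ?z = "picard_dx n"
  define m where "m = p * (2 * M) powr (p - 1) * slope_bound + (2 * M) powr p * \<bar>1 + a\<bar>"
  have "\<bar>solve_dx ?v ?z x t\<bar> \<le> N + m * wt_mass a (T + R)"
  proof (rule wave_bound)
    fix y s assume s: "s \<in> {0..T}"
    have "\<bar>spow (p - 1) (?v y s)\<bar> \<le> (2 * M) powr (p - 1)"
      unfolding abs_spow using admissible_picard[of n] s p
      by (intro powr_mono2) (auto simp: admissible_def)
    then have "\<bar>p * spow (p - 1) (?v y s) * ?z y s * wt a y\<bar> \<le> p * (2 * M) powr (p - 1) * slope_bound * wt a y"
      using Suc.IH[OF s, of y] wt_pos[of a y] p slope_bound_nonneg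
      by (auto simp: abs_mult intro!: mult_mono)
    moreover have "\<bar>\<bar>?v y s\<bar> powr p * wt' a y\<bar> \<le> (2 * M) powr p * (\<bar>1 + a\<bar> * wt a y)"
      using source_bound(1)[OF admissible_picard s] wt'_bound[of a y]
      by (auto simp: abs_mult intro!: mult_mono)
    ultimately show "\<bar>source_dx p a ?v ?z y s\<bar> \<le> m * wt a y"
      unfolding source_dx_def m_def by (simp add: distrib_right mult.assoc)
  next
    show "0 \<le> m" using p slope_bound_nonneg by (simp add: m_def)
  next
    fix y s assume "s \<in> {0..T}" "T + R < \<bar>y\<bar>"
    then have "?v y s = 0" using admissible_picard[of n] by (auto simp: admissible_def)
    then show "source_dx p a ?v ?z y s = 0" by (simp add: source_dx_def spow_def)
  qed (use Suc.prems bound' p in \<open>auto intro!: continuous_on_source_dx continuous_on_picard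
      continuous_on_picard_dx\<close>)
  also have "\<dots> = N + slope_bound * (p * (2 * M) powr (p - 1) * wt_mass a (T + R)) +
      \<bar>1 + a\<bar> * ((2 * M) powr p * wt_mass a (T + R))"
    by (simp add: m_def algebra_simps)
  also have "\<dots> \<le> N + slope_bound * (1/2) + \<bar>1 + a\<bar> * M"
    by (intro add_mono mult_left_mono small mass_bound slope_bound_nonneg) auto
  also have "\<dots> = slope_bound" by (simp add: slope_bound_def)
  finally show ?case by simp
qed

text \<open>Changing the derivative argument costs the contraction factor \<open>1/2\<close>. Changing the coefficient
  \<open>u\<close> costs only a multiple of its change, since the odd power \<open>p - 1 \<ge> 1\<close> is Lipschitz; the multiple may
  be large, but the changes it is applied to already decay geometrically.\<close>
lemma solve_dx_diff:
  assumes "admissible u" "admissible v"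
    and z: "continuous_on (strip T) (case_prod z)" "continuous_on (strip T) (case_prod z')"
    and bd: "\<And>x t. t \<in> {0..T} \<Longrightarrow> \<bar>z' x t\<bar> \<le> slope_bound"
    and d: "\<And>x t. t \<in> {0..T} \<Longrightarrow> \<bar>u x t - v x t\<bar> \<le> d"
    and e: "\<And>x t. t \<in> {0..T} \<Longrightarrow> \<bar>z x t - z' x t\<bar> \<le> e"
    and t: "t \<in> {0..T}"
  shows "\<bar>solve_dx u z x t - solve_dx v z' x t\<bar> \<le>
    e / 2 + (p * (p - 1) * (2 * M) powr (p - 2) * slope_bound + p * (2 * M) powr (p - 1) * \<bar>1 + a\<bar>) *
      wt_mass a (T + R) * d"
proof -
  define K where "K = p * (2 * M) powr (p - 1)"
  define K' where "K' = (p - 1) * (2 * M) powr (p - 2)"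
  define m where "m = K * e + p * (K' * d) * slope_bound + K * d * \<bar>1 + a\<bar>"
  have de: "0 \<le> d" "0 \<le> e" using d[OF t, of x] e[OF t, of x] by linarith+
  have K: "0 \<le> K" "0 \<le> K'" using p by (auto simp: K_def K'_def)
  have "\<bar>solve_dx u z x t - solve_dx v z' x t\<bar> \<le> m * wt_mass a (T + R)"
  proof (rule wave_diff_bound)
    fix y s assume s: "s \<in> {0..T}"
    have uv: "\<bar>u y s\<bar> \<le> 2 * M" "\<bar>v y s\<bar> \<le> 2 * M"
      using assms(1,2) s by (auto simp: admissible_def)
    have 1: "\<bar>spow (p - 1) (u y s)\<bar> \<le> (2 * M) powr (p - 1)"
      unfolding abs_spow using uv p by (intro powr_mono2) auto
    have "\<bar>spow (p - 1) (u y s) - spow (p - 1) (v y s)\<bar> \<le> K' * \<bar>u y s - v y s\<bar>"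
      using spow_Lipschitz[OF _ uv, of "p - 1"] p2 by (simp add: K'_def)
    also have "\<dots> \<le> K' * d" using d[OF s] K by (intro mult_left_mono)
    finally have 2: "\<bar>spow (p - 1) (u y s) - spow (p - 1) (v y s)\<bar> \<le> K' * d" .
    have "\<bar>\<bar>u y s\<bar> powr p - \<bar>v y s\<bar> powr p\<bar> \<le> K * \<bar>u y s - v y s\<bar>"
      unfolding K_def using uv p by (intro abs_powr_Lipschitz) auto
    also have "\<dots> \<le> K * d" using d[OF s] K by (intro mult_left_mono)
    finally have 3: "\<bar>\<bar>u y s\<bar> powr p - \<bar>v y s\<bar> powr p\<bar> \<le> K * d" .
    have "\<bar>p * spow (p - 1) (u y s) * (z y s - z' y s) * wt a y\<bar> \<le> K * e * wt a y"
      using 1 e[OF s, of y] wt_pos[of a y] p de by (auto simp: abs_mult K_def intro!: mult_mono)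
    moreover have "\<bar>p * (spow (p - 1) (u y s) - spow (p - 1) (v y s)) * z' y s * wt a y\<bar>
        \<le> p * E * slope_bound * wt a y" if "\<bar>spow (p - 1) (u y s) - spow (p - 1) (v y s)\<bar> \<le> E" for E
      using that bd[OF s, of y] wt_pos[of a y] p by (auto simp: abs_mult intro!: mult_mono)
    from this[OF 2] have "\<bar>p * (spow (p - 1) (u y s) - spow (p - 1) (v y s)) * z' y s * wt a y\<bar>
        \<le> p * (K' * d) * slope_bound * wt a y" .
    moreover have "\<bar>(\<bar>u y s\<bar> powr p - \<bar>v y s\<bar> powr p) * wt' a y\<bar> \<le> K * d * (\<bar>1 + a\<bar> * wt a y)"
      unfolding abs_mult using 3 wt'_bound[of a y] K de by (intro mult_mono) auto
    moreover have "source_dx p a u z y s - source_dx p a v z' y s =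
        p * spow (p - 1) (u y s) * (z y s - z' y s) * wt a y +
        p * (spow (p - 1) (u y s) - spow (p - 1) (v y s)) * z' y s * wt a y +
        (\<bar>u y s\<bar> powr p - \<bar>v y s\<bar> powr p) * wt' a y"
      by (simp add: source_dx_def algebra_simps)
    moreover have "m * wt a y = K * e * wt a y + p * (K' * d) * slope_bound * wt a y + K * d * (\<bar>1 + a\<bar> * wt a y)"
      by (simp add: m_def algebra_simps)
    ultimately show "\<bar>source_dx p a u z y s - source_dx p a v z' y s\<bar> \<le> m * wt a y"
      by linarith
  next
    show "0 \<le> m" using p de K slope_bound_nonneg by (simp add: m_def)
  qed (use assms(1,2) z p t in \<open>auto simp: admissible_def source_dx_def spow_def
      intro!: continuous_on_source_dx\<close>)
  also have "\<dots> = e * (p * (2 * M) powr (p - 1) * wt_mass a (T + R)) +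
      (p * (p - 1) * (2 * M) powr (p - 2) * slope_bound + p * (2 * M) powr (p - 1) * \<bar>1 + a\<bar>) *
      wt_mass a (T + R) * d"
    by (simp add: m_def K_def K'_def algebra_simps)
  also have "e * (p * (2 * M) powr (p - 1) * wt_mass a (T + R)) \<le> e * (1/2)"
    by (intro mult_left_mono small de)
  finally show ?thesis by simp
qed

text \<open>The increments satisfy \<open>e\<^bsub>n + 1\<^esub> \<le> e\<^sub>n / 2 + 2 M C (1/2)\<^sup>n\<close>. The forcing has the same ratio as the
  contraction, so a slightly larger ratio \<open>3/4\<close> is used to absorb it.\<close>
lemma picard_dx_step:
  obtains D where
    "\<And>n x t. t \<in> {0..T} \<Longrightarrow> \<bar>picard_dx (Suc n) x t - picard_dx n x t\<bar> \<le> D * (3/4) ^ n"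
proof -
  define C where "C = (p * (p - 1) * (2 * M) powr (p - 2) * slope_bound +
      p * (2 * M) powr (p - 1) * \<bar>1 + a\<bar>) * wt_mass a (T + R)"
  \<comment> \<open>The first summand starts the induction; the second makes \<open>2 M C \<le> D / 4\<close>, which closes it.\<close>
  define D where "D = slope_bound + 8 * M * C"
  have C: "0 \<le> C"
    using p slope_bound_nonneg wt_mass_nonneg by (simp add: C_def)
  have "\<bar>picard_dx (Suc n) x t - picard_dx n x t\<bar> \<le> D * (3/4) ^ n" if "t \<in> {0..T}" for n x t
    using that
  proof (induction n arbitrary: x t)
    case 0
    then show ?case using picard_dx_bound[OF 0, of "Suc 0" x] mult_nonneg_nonneg[OF less_imp_le[OF M] C]
      by (simp add: D_def)
  next
    case (Suc n)
    have "\<bar>picard_dx (Suc (Suc n)) x t - picard_dx (Suc n) x t\<bar> \<le>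
        D * (3/4) ^ n / 2 + C * (2 * M * (1/2) ^ n)"
      using solve_dx_diff[OF admissible_picard admissible_picard continuous_on_picard_dx
          continuous_on_picard_dx picard_dx_bound picard_step Suc.IH Suc.prems]
      by (simp add: C_def)
    also have "(1/2) ^ n \<le> (3/4 :: real) ^ n"
      by (rule power_mono) auto
    then have "D * (3/4) ^ n / 2 + C * (2 * M * (1/2) ^ n) \<le> (D / 2 + 2 * M * C) * (3/4) ^ n"
      using C M mult_left_mono[of "(1/2) ^ n" "(3/4 :: real) ^ n" "C * (2 * M)"]
      by (simp add: algebra_simps)
    also have "D / 2 + 2 * M * C \<le> D * (3/4)"
      using slope_bound_nonneg by (simp add: D_def)
    then have "(D / 2 + 2 * M * C) * (3/4) ^ n \<le> D * (3/4) * (3/4) ^ n"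
      by (rule mult_right_mono) simp
    finally show ?case by simp
  qed
  then show ?thesis by (rule that)
qed

lemma picard_limit_C1:
  obtains U W where "admissible U" "\<And>x t. t \<in> {0..T} \<Longrightarrow> U x t = solve U x t"
    "continuous_on (strip T) (case_prod W)"
    "\<And>x t. t \<in> {0..T} \<Longrightarrow> ((\<lambda>y. U y t) has_real_derivative W x t) (at x)"
proof -
  obtain U where U: "uniform_limit (strip T) (\<lambda>n. case_prod (picard n)) (case_prod U) sequentially"
    "admissible U" "\<And>x t. t \<in> {0..T} \<Longrightarrow> U x t = solve U x t"
    by (rule picard_limit) blast
  obtain D where D: "\<And>n x t. t \<in> {0..T} \<Longrightarrow> \<bar>picard_dx (Suc n) x t - picard_dx n x t\<bar> \<le> D * (3/4) ^ n"
    by (rule picard_dx_step) blast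
  obtain L where L: "uniform_limit (strip T) (\<lambda>n. case_prod (picard_dx n)) L sequentially"
    by (rule geometric_uniform_limit[where S = "strip T" and F = "\<lambda>n. case_prod (picard_dx n)"
          and D = D and q = "3/4"])
      (use D in \<open>auto simp: strip_def\<close>)
  define W where "W x t = L (x, t)" for x t
  have W: "uniform_limit (strip T) (\<lambda>n. case_prod (picard_dx n)) (case_prod W) sequentially"
    using L by (simp add: W_def[abs_def])
  have "continuous_on (strip T) (case_prod W)"
    by (intro uniform_limit_theorem[OF _ W]) (auto simp: continuous_on_picard_dx)
  moreover have "((\<lambda>y. U y t) has_real_derivative W x t) (at x)" if t: "t \<in> {0..T}" for x t
  proof -
    have lim: "(\<lambda>n. picard n y t) \<longlonglongrightarrow> U y t" for y
      using tendsto_uniform_limitI[OF U(1), of "(y, t)"] t by (simp add: strip_def)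
    have "\<exists>g. \<forall>y\<in>UNIV. (\<lambda>n. picard n y t) \<longlonglongrightarrow> g y \<and> (g has_derivative (*) (W y t)) (at y within UNIV)"
    proof (rule has_derivative_sequence[where f = "\<lambda>n y. picard n y t" and
            f' = "\<lambda>n y. (*) (picard_dx n y t)", OF convex_UNIV _ _ UNIV_I lim[of 0]])
      show "((\<lambda>y. picard n y t) has_derivative (*) (picard_dx n y t)) (at y within UNIV)" for n y
        using picard_has_derivative[OF t] by (simp add: has_field_derivative_def)
      fix e :: real assume "0 < e"
      from uniform_limitD[OF W this]
      show "\<forall>\<^sub>F n in sequentially. \<forall>y\<in>UNIV. \<forall>h. norm (picard_dx n y t * h - W y t * h) \<le> e * norm h"
      proof eventually_elim
        case (elim n)
        have "\<bar>picard_dx n y t - W y t\<bar> \<le> e" for y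
          using bspec[OF elim, of "(y, t)"] t by (simp add: strip_def dist_real_def)
        then show ?case
          by (auto simp: abs_mult simp flip: left_diff_distrib intro!: mult_right_mono)
      qed
    qed
    then obtain g where g: "\<And>y. (\<lambda>n. picard n y t) \<longlonglongrightarrow> g y"
      "\<And>y. (g has_derivative (*) (W y t)) (at y)"
      by auto
    have "g = (\<lambda>y. U y t)"
      using LIMSEQ_unique[OF g(1) lim] by auto
    then show ?thesis using g(2)[of x] by (simp add: has_field_derivative_def)
  qed
  ultimately show ?thesis using that[OF U(2,3)] by blast
qed

end

section \<open>Growth of the weight integral and the lifespan\<close>

text \<open>Comparison with a power of \<open>1 + \<bar>y\<bar>\<close>, which has an elementary antiderivative. It rests on
  \<open>(1 + \<bar>y\<bar>)\<^sup>2 / 2 \<le> 1 + y\<^sup>2 \<le> (1 + \<bar>y\<bar>)\<^sup>2\<close>; the sign of \<open>1 + a\<close> decides which half matters.\<close>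
lemma wt_le: "wt a y \<le> 2 powr \<bar>(1 + a) / 2\<bar> * (1 + \<bar>y\<bar>) powr (- (1 + a))"
proof -
  define b where "b = (1 + a) / 2"
  have sq: "((1 + \<bar>y\<bar>)\<^sup>2) powr (- b) = (1 + \<bar>y\<bar>) powr (- (1 + a))"
  proof -
    have "((1 + \<bar>y\<bar>)\<^sup>2) powr (- b) = ((1 + \<bar>y\<bar>) powr 2) powr (- b)" by simp
    also have "\<dots> = (1 + \<bar>y\<bar>) powr (2 * - b)" by (rule powr_powr)
    also have "2 * - b = - (1 + a)" by (simp add: b_def field_simps)
    finally show ?thesis .
  qed
  have "wt a y \<le> 2 powr \<bar>b\<bar> * ((1 + \<bar>y\<bar>)\<^sup>2) powr (- b)"
  proof (cases "0 \<le> b")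
    case True
    have "0 \<le> (1 - \<bar>y\<bar>)\<^sup>2" by simp
    then have "(1 + \<bar>y\<bar>)\<^sup>2 / 2 \<le> 1 + y\<^sup>2"
      by (simp add: power2_eq_square algebra_simps)
    then have "(1 + y\<^sup>2) powr (- b) \<le> ((1 + \<bar>y\<bar>)\<^sup>2 / 2) powr (- b)"
      using True by (intro powr_mono2') auto
    also have "\<dots> = 2 powr b * ((1 + \<bar>y\<bar>)\<^sup>2) powr (- b)"
      by (simp add: powr_divide powr_minus_divide)
    finally show ?thesis using True by (simp add: wt_eq_powr b_def)
  next
    case False
    have "1 + y\<^sup>2 \<le> (1 + \<bar>y\<bar>)\<^sup>2"
      by (simp add: power2_eq_square algebra_simps)
    then have "(1 + y\<^sup>2) powr (- b) \<le> 1 * ((1 + \<bar>y\<bar>)\<^sup>2) powr (- b)"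
      using False by (simp add: powr_mono2)
    also have "\<dots> \<le> 2 powr \<bar>b\<bar> * ((1 + \<bar>y\<bar>)\<^sup>2) powr (- b)"
      by (intro mult_right_mono) (auto simp: ge_one_powr_ge_zero)
    finally show ?thesis by (simp add: wt_eq_powr b_def)
  qed
  then show ?thesis by (simp only: sq flip: b_def)
qed

lemma wt_mass_le:
  assumes \<rho>: "0 \<le> \<rho>" and F: "\<And>y. 0 \<le> y \<Longrightarrow> (F has_real_derivative (1 + y) powr (- (1 + a))) (at y)"
  shows "wt_mass a \<rho> \<le> 2 * 2 powr \<bar>(1 + a) / 2\<bar> * (F \<rho> - F 0)"
proof -
  have int: "wt a integrable_on {u..v}" for u v
    by (intro integrable_continuous_real continuous_on_wt)
  have wt_even: "wt a (- y) = wt a y" for y by (simp add: wt_def)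
  have "integral {-\<rho>..0} (wt a) = integral {0..\<rho>} (wt a)"
    using Henstock_Kurzweil_Integration.integral_reflect_real[of \<rho> 0 "wt a"]
    by (simp add: wt_even)
  moreover have "integral {-\<rho>..0} (wt a) + integral {0..\<rho>} (wt a) = wt_mass a \<rho>"
    unfolding wt_mass_def by (rule Henstock_Kurzweil_Integration.integral_combine) (use \<rho> int in auto)
  moreover have "integral {0..\<rho>} (wt a) \<le> 2 powr \<bar>(1 + a) / 2\<bar> * (F \<rho> - F 0)"
  proof -
    have "((\<lambda>y. (1 + y) powr (- (1 + a))) has_integral F \<rho> - F 0) {0..\<rho>}"
      using \<rho> F by (intro fundamental_theorem_of_calculus)
        (auto simp: has_real_derivative_iff_has_vector_derivative[symmetric]
          intro: has_field_derivative_at_within)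
    from has_integral_mult_right[OF this, of "2 powr \<bar>(1 + a) / 2\<bar>"]
    show ?thesis
      by (rule has_integral_le[OF integrable_integral[OF int]]) (metis wt_le abs_of_nonneg atLeastAtMost_iff)
  qed
  ultimately show ?thesis by simp
qed

text \<open>The three regimes are put in one form so that they can be used together: \<open>X\<close> stands for a bound
  on the growing part of the integral, which is \<open>T\<^bsup>-a\<^esup>\<close> for \<open>a < 0\<close>, \<open>log T\<close> for \<open>a = 0\<close> and
  absent for \<open>a > 0\<close>. The additive \<open>1\<close> absorbs what \<open>R\<close> contributes when \<open>T\<close> is small.\<close>
lemma wt_mass_growth:
  assumes R: "0 \<le> R"
  obtains P where "0 < P"
    "\<And>T X. 0 < T \<Longrightarrow> 0 \<le> X \<Longrightarrow> (a < 0 \<Longrightarrow> T powr (- a) \<le> X) \<Longrightarrow> (a = 0 \<Longrightarrow> T \<le> exp X) \<Longrightarrow>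
      wt_mass a (T + R) \<le> P * (1 + X)"
proof -
  define K where "K = 2 * 2 powr \<bar>(1 + a) / 2\<bar>"
  have K: "0 < K" by (simp add: K_def)
  have nonzero: "wt_mass a \<rho> \<le> K * (((1 + \<rho>) powr (- a) - 1) / (- a))" if "a \<noteq> 0" "0 \<le> \<rho>" for \<rho>
  proof -
    have "((\<lambda>y. (1 + y) powr (- a) / (- a)) has_real_derivative (1 + y) powr (- (1 + a))) (at y)"
      if "0 \<le> y" for y
    proof -
      have "((\<lambda>y. (1 + y) powr (- a)) has_real_derivative - a * (1 + y) powr (- a - 1) * 1) (at y)"
        by (rule DERIV_chain2[OF has_real_derivative_powr])
          (use that in \<open>auto intro!: derivative_eq_intros\<close>)
      moreover have "- a - 1 = - (1 + a)" by simp
      ultimately have "((\<lambda>y. (1 + y) powr (- a)) has_real_derivative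
          - a * (1 + y) powr (- (1 + a))) (at y)" by (simp only: mult_1_right)
      from DERIV_cdivide[OF this, of "- a"] show ?thesis
        using \<open>a \<noteq> 0\<close> by simp
    qed
    from wt_mass_le[OF \<open>0 \<le> \<rho>\<close> this] show ?thesis
      by (simp add: K_def diff_divide_distrib)
  qed
  consider "0 < a" | "a = 0" | "a < 0" by linarith
  then show ?thesis
  proof cases
    case 1
    have "wt_mass a (T + R) \<le> K / a * (1 + X)" if "0 < T" "0 \<le> X" for T X
    proof -
      have "wt_mass a (T + R) \<le> K * (((1 + (T + R)) powr (- a) - 1) / (- a))"
        using nonzero[of "T + R"] 1 R that by simp
      also have "\<dots> = K / a * (1 - (1 + (T + R)) powr (- a))"
        using 1 by (simp add: field_simps)
      also have "\<dots> \<le> K / a * (1 + X)"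
        using K 1 that by (intro mult_left_mono) (auto intro: order_trans[of _ 0])
      finally show ?thesis .
    qed
    then show ?thesis using K 1 by (intro that[of "K / a"]) auto
  next
    case 2
    define P where "P = K * (ln (2 + R) + 1)"
    have "wt_mass a (T + R) \<le> P * (1 + X)" if T: "0 < T" "0 \<le> X" "T \<le> exp X" for T X
    proof -
      have grow: "ln (1 + (T + R)) \<le> (ln (2 + R) + 1) * (1 + X)"
      proof -
        have "(1 + R) * 1 \<le> (1 + R) * exp X" using R T by (intro mult_left_mono) auto
        then have "ln (1 + (T + R)) \<le> ln ((2 + R) * exp X)"
          using T R by (subst ln_le_cancel_iff) (auto simp: algebra_simps)
        also have "\<dots> = ln (2 + R) + X" using R by (simp add: ln_mult)
        also have "\<dots> \<le> (ln (2 + R) + 1) * (1 + X)" using R T by (simp add: algebra_simps)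
        finally show ?thesis .
      qed
      have "((\<lambda>y. ln (1 + y)) has_real_derivative (1 + y) powr (- (1 + a))) (at y)" if "0 \<le> y" for y
        using that 2 by (auto intro!: derivative_eq_intros simp: powr_minus_divide)
      from wt_mass_le[OF _ this, of "T + R"] have "wt_mass a (T + R) \<le> K * ln (1 + (T + R))"
        using T R by (simp add: K_def)
      also have "\<dots> \<le> K * ((ln (2 + R) + 1) * (1 + X))"
        using K by (intro mult_left_mono grow) auto
      finally show ?thesis by (simp add: P_def mult.assoc)
    qed
    moreover have "0 < P" using K R by (simp add: P_def add_pos_pos)
    ultimately show ?thesis using 2 by (intro that[of P]) auto
  next
    case 3
    define b where "b = - a"
    have b: "0 < b" using 3 by (simp add: b_def)
    define P where "P = K / b * 2 powr b * ((1 + R) powr b + 1)"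
    have "wt_mass a (T + R) \<le> P * (1 + X)" if T: "0 < T" "0 \<le> X" "T powr b \<le> X" for T X
    proof -
      have "(1 + (T + R)) powr b \<le> (2 * max (1 + R) T) powr b"
        using T R b by (intro powr_mono2) (auto simp: max_def)
      also have "\<dots> = 2 powr b * max (1 + R) T powr b"
        using T R by (simp add: powr_mult)
      also have "\<dots> \<le> 2 powr b * (((1 + R) powr b + 1) * (1 + X))"
      proof (intro mult_left_mono)
        have "max (1 + R) T powr b \<le> (1 + R) powr b + X"
          using T by (auto simp: max_def intro: add_increasing)
        also have "\<dots> \<le> ((1 + R) powr b + 1) * (1 + X)"
          using T by (simp add: algebra_simps)
        finally show "max (1 + R) T powr b \<le> ((1 + R) powr b + 1) * (1 + X)" .
      qed simp
      finally have grow: "(1 + (T + R)) powr b \<le> 2 powr b * (((1 + R) powr b + 1) * (1 + X))" .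
      have "wt_mass a (T + R) \<le> K * (((1 + (T + R)) powr b - 1) / b)"
        using nonzero[of "T + R"] 3 R T by (simp add: b_def)
      also have "\<dots> \<le> K / b * (1 + (T + R)) powr b"
        using K b by (simp add: field_simps)
      also have "\<dots> \<le> K / b * (2 powr b * (((1 + R) powr b + 1) * (1 + X)))"
        using K b grow by (intro mult_left_mono) auto
      finally show ?thesis by (simp add: P_def mult.assoc)
    qed
    moreover have "0 < P" using K b R by (simp add: P_def add_nonneg_pos)
    ultimately show ?thesis using 3 by (intro that[of P]) (auto simp: b_def)
  qed
qed

definition lifespan_bound :: "real \<Rightarrow> real \<Rightarrow> real \<Rightarrow> real \<Rightarrow> real \<Rightarrow> bool" where
  "lifespan_bound p a c \<epsilon> T \<longleftrightarrow>
    (a < 0 \<longrightarrow> T \<le> c * \<epsilon> powr (- (p - 1) / (- a))) \<and>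
    (a = 0 \<longrightarrow> T \<le> exp (c * \<epsilon> powr (- (p - 1))))"

text \<open>With \<open>\<delta> = \<epsilon>\<^bsup>p - 1\<^esup>\<close> the lifespan condition says that the growing part of the integral is at most a small
  multiple \<open>d / \<delta>\<close>. Then \<open>\<delta> (1 + d / \<delta>) = \<delta> + d\<close>, which is small as soon as \<open>\<delta> \<le> d\<close>; the latter
  is the requirement \<open>\<epsilon> \<le> \<epsilon>\<^sub>1\<close>.\<close>
lemma smallness:
  assumes p: "1 < p" and R: "0 \<le> R" and A: "0 < A"
  obtains \<epsilon>\<^sub>1 c where "0 < \<epsilon>\<^sub>1" "0 < c"
    "\<And>\<epsilon> T. 0 < \<epsilon> \<Longrightarrow> \<epsilon> \<le> \<epsilon>\<^sub>1 \<Longrightarrow> 0 < T \<Longrightarrow> lifespan_bound p a c \<epsilon> T \<Longrightarrow>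
      A * \<epsilon> powr (p - 1) * wt_mass a (T + R) \<le> 1/2"
proof -
  obtain P where P: "0 < P"
    "\<And>T X. 0 < T \<Longrightarrow> 0 \<le> X \<Longrightarrow> (a < 0 \<Longrightarrow> T powr (- a) \<le> X) \<Longrightarrow> (a = 0 \<Longrightarrow> T \<le> exp X) \<Longrightarrow>
      wt_mass a (T + R) \<le> P * (1 + X)"
    by (rule wt_mass_growth[OF R, of a]) blast
  define d where "d = 1 / (4 * A * P)"
  have d: "0 < d" using A P by (simp add: d_def)
  define \<epsilon>\<^sub>1 where "\<epsilon>\<^sub>1 = d powr (1 / (p - 1))"
  define c where "c = (if a < 0 then d powr (1 / (- a)) else d)"
  have "A * \<epsilon> powr (p - 1) * wt_mass a (T + R) \<le> 1/2"
    if \<epsilon>: "0 < \<epsilon>" "\<epsilon> \<le> \<epsilon>\<^sub>1" and T: "0 < T" and bd: "lifespan_bound p a c \<epsilon> T" for \<epsilon> T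
  proof -
    define \<delta> where "\<delta> = \<epsilon> powr (p - 1)"
    have \<delta>: "0 < \<delta>" using \<epsilon> by (simp add: \<delta>_def)
    have "\<epsilon> powr (p - 1) \<le> \<epsilon>\<^sub>1 powr (p - 1)" using \<epsilon> p by (intro powr_mono2) auto
    also have "\<dots> = d" using p d by (simp add: \<epsilon>\<^sub>1_def powr_powr)
    finally have \<delta>d: "\<delta> \<le> d" by (simp add: \<delta>_def)
    have inv: "\<epsilon> powr (- (p - 1)) = 1 / \<delta>" by (simp add: \<delta>_def powr_minus_divide del: minus_diff_eq)
    have "T powr (- a) \<le> d / \<delta>" if "a < 0"
    proof -
      have "T powr (- a) \<le> (c * \<epsilon> powr (- (p - 1) / (- a))) powr (- a)"
        using bd T that by (intro powr_mono2) (auto simp: lifespan_bound_def)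
      also have "\<dots> = d * \<epsilon> powr (- (p - 1))"
        using that d by (simp add: c_def powr_mult powr_powr)
      finally show ?thesis by (simp only: inv times_divide_eq_right mult_1_right)
    qed
    moreover have "T \<le> exp (d / \<delta>)" if "a = 0"
      using bd that inv by (simp add: lifespan_bound_def c_def)
    ultimately have "wt_mass a (T + R) \<le> P * (1 + d / \<delta>)"
      using P(2)[of T "d / \<delta>"] T d \<delta> by simp
    then have "A * \<delta> * wt_mass a (T + R) \<le> A * \<delta> * (P * (1 + d / \<delta>))"
      using A \<delta> by (intro mult_left_mono) auto
    also have "\<dots> = A * P * (\<delta> + d)" using \<delta> by (simp add: field_simps)
    also have "\<dots> \<le> A * P * (d + d)" using A P \<delta>d by (intro mult_left_mono) auto
    also have "\<dots> = 1/2" using A P by (simp add: d_def)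
    finally show ?thesis by (simp add: \<delta>_def)
  qed
  moreover have "0 < \<epsilon>\<^sub>1" "0 < c" using d by (auto simp: \<epsilon>\<^sub>1_def c_def)
  ultimately show ?thesis by (intro that[of \<epsilon>\<^sub>1 c])
qed

section \<open>The initial data and the conclusion\<close>

lemma vanishes_outside:
  fixes h :: "real \<Rightarrow> real"
  assumes "supp UNIV h \<subseteq> {x. \<bar>x\<bar> \<le> R}" "R < \<bar>x\<bar>"
  shows "h x = 0"
proof (rule ccontr)
  assume "h x \<noteq> 0"
  then have "x \<in> supp UNIV h"
    unfolding supp_def by (intro subsetD[OF closure_subset]) (simp add: support_on_def)
  with assms show False by auto
qed

lemma deriv_vanishes_outside:
  fixes h :: "real \<Rightarrow> real"
  assumes "\<And>x. R < \<bar>x\<bar> \<Longrightarrow> h x = 0" "R < \<bar>x\<bar>"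
  shows "deriv h x = 0"
proof (rule DERIV_imp_deriv)
  have "open {x::real. R < \<bar>x\<bar>}"
    by (intro open_Collect_less continuous_intros)
  then show "(h has_real_derivative 0) (at x)"
    by (rule has_field_derivative_transform_within_open[OF DERIV_const])
      (use assms in simp_all)
qed

lemma bounded_if_vanishes_outside:
  fixes h :: "real \<Rightarrow> real"
  assumes "continuous_on UNIV h" "\<And>x. R < \<bar>x\<bar> \<Longrightarrow> h x = 0"
  shows "\<exists>M>0. \<forall>x. \<bar>h x\<bar> \<le> M"
proof -
  have "compact (h ` {-R..R})"
    by (intro compact_continuous_image continuous_on_subset[OF assms(1)]) auto
  then obtain M where M: "0 < M" "\<And>x. x \<in> {-R..R} \<Longrightarrow> \<bar>h x\<bar> \<le> M"
    using compact_imp_bounded bounded_pos by (metis imageI real_norm_def)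
  have "\<bar>h x\<bar> \<le> M" for x
    using M(1) M(2)[of x] assms(2)[of x] by (cases "R < \<bar>x\<bar>") (auto simp: not_less abs_le_iff)
  with M(1) show ?thesis by blast
qed

lemma Ck_Suc_D:
  assumes "f \<in> Ck (Suc k)"
  shows "(f has_real_derivative deriv f x) (at x)" "deriv f \<in> Ck k"
proof -
  have d: "(deriv ^^ j) f differentiable_on UNIV" if "j < Suc k" for j
    using assms that by (simp add: Ck_def)
  from d[of 0] show "(f has_real_derivative deriv f x) (at x)"
    by (auto simp: differentiable_on_def real_differentiable_def DERIV_deriv_iff_real_differentiable)
  have "(deriv ^^ j) (deriv f) = (deriv ^^ Suc j) f" for j
    by (simp only: funpow_Suc_right o_def)
  then show "deriv f \<in> Ck k"
    using assms d by (auto simp: Ck_def simp del: funpow.simps)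
qed

lemma Ck_continuous:
  assumes "f \<in> Ck k"
  shows "continuous_on UNIV f"
proof (cases k)
  case 0
  with assms show ?thesis by (simp add: Ck_def)
next
  case (Suc n)
  have "(f has_real_derivative deriv f x) (at x)" for x
    using Ck_Suc_D(1) assms Suc by blast
  then show ?thesis
    by (meson DERIV_isCont continuous_at_imp_continuous_on)
qed

text \<open>The integral equation for \<open>U\<close> in terms of \<open>free_dt\<close> and \<open>L'\<close> is the fixed point equation of the
  iteration, with the terms grouped by origin instead of by direction of propagation.\<close>
lemma wave_eq_integral_equation:
  "wave (\<lambda>y. \<epsilon> * (deriv f y + g y)) (\<lambda>y. \<epsilon> * (g y - deriv f y)) (source p a U) x t =
    \<epsilon> * free_dt f g x t + L' a (\<lambda>y s. \<bar>U y s\<bar> powr p) x t"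
  by (simp add: wave_def transport_def free_dt_def L'_def ray_int_eq source_def wt_def algebra_simps)

theorem theorem2p1:
  fixes p a R :: real and f g :: "real \<Rightarrow> real"
  assumes "p > 1" and "R \<ge> 1"
    and "f \<in> Ck_compact_supp 2" and "g \<in> Ck_compact_supp 1"
    and "supp UNIV f \<subseteq> {x. \<bar>x\<bar> \<le> R}" and "supp UNIV g \<subseteq> {x. \<bar>x\<bar> \<le> R}"
  shows "\<exists>\<epsilon>\<^sub>1>0. \<exists>c>0. \<forall>\<epsilon> T. 0 < \<epsilon> \<and> \<epsilon> \<le> \<epsilon>\<^sub>1 \<and> 0 < T \<and>
           (a < 0 \<longrightarrow> T \<le> c * \<epsilon> powr (- (p - 1) / (- a))) \<and>
           (a = 0 \<longrightarrow> T \<le> exp (c * \<epsilon> powr (- (p - 1)))) \<longrightarrow>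
         (p \<ge> 2 \<longrightarrow> (\<exists>u. classical_solution p a f g \<epsilon> T u)) \<and>
         (p < 2 \<longrightarrow> (\<exists>U. continuous_on (strip T) (\<lambda>(x, t). U x t) \<and>
            supp (strip T) (\<lambda>(x, t). U x t) \<subseteq> {(x, t) \<in> strip T. \<bar>x\<bar> \<le> t + R} \<and>
            (\<forall>x. \<forall>t\<in>{0..T}.
               U x t = \<epsilon> * free_dt f g x t + L' a (\<lambda>y s. \<bar>U y s\<bar> powr p) x t)))"
proof -
  have f: "f \<in> Ck (Suc (Suc 0))" and g: "g \<in> Ck (Suc 0)"
    using assms(3,4) by (simp_all add: Ck_compact_supp_def numeral_2_eq_2)
  define f' where "f' = deriv f"
  have f': "f' \<in> Ck (Suc 0)" using Ck_Suc_D(2)[OF f] by (simp add: f'_def)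
  have van: "f' y = 0" "g y = 0" if "R < \<bar>y\<bar>" for y
    using deriv_vanishes_outside[OF vanishes_outside[OF assms(5)] that]
      vanishes_outside[OF assms(6) that] by (auto simp: f'_def)
  have van': "deriv f' y = 0" "deriv g y = 0" if "R < \<bar>y\<bar>" for y
    using deriv_vanishes_outside[OF van(1) that] deriv_vanishes_outside[OF van(2) that] by auto
  obtain Mf where Mf: "0 < Mf" "\<And>y. \<bar>f' y\<bar> \<le> Mf"
    using bounded_if_vanishes_outside[OF Ck_continuous[OF f'] van(1)] by blast
  obtain Mg where Mg: "0 < Mg" "\<And>y. \<bar>g y\<bar> \<le> Mg"
    using bounded_if_vanishes_outside[OF Ck_continuous[OF g] van(2)] by blast
  obtain Nf where Nf: "0 < Nf" "\<And>y. \<bar>deriv f' y\<bar> \<le> Nf"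
    using bounded_if_vanishes_outside[OF Ck_continuous[OF Ck_Suc_D(2)[OF f']] van'(1)] by blast
  obtain Ng where Ng: "0 < Ng" "\<And>y. \<bar>deriv g y\<bar> \<le> Ng"
    using bounded_if_vanishes_outside[OF Ck_continuous[OF Ck_Suc_D(2)[OF g]] van'(2)] by blast
  note pos = Mf(1) Mg(1) Nf(1) Ng(1) and bounds = Mf(2) Mg(2) Nf(2) Ng(2)
  define M where "M = Mf + Mg"
  define A where "A = p * (2 * M) powr (p - 1)"
  have "0 < A" using pos assms(1) by (simp add: A_def M_def)
  then obtain \<epsilon>\<^sub>1 c where ec: "0 < \<epsilon>\<^sub>1" "0 < c"
    and small: "\<And>\<epsilon> T. 0 < \<epsilon> \<Longrightarrow> \<epsilon> \<le> \<epsilon>\<^sub>1 \<Longrightarrow> 0 < T \<Longrightarrow> lifespan_bound p a c \<epsilon> T \<Longrightarrow>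
      A * \<epsilon> powr (p - 1) * wt_mass a (T + R) \<le> 1/2"
    using smallness[of p R A a] assms(1,2) by auto
  show ?thesis
  proof (rule exI[of _ \<epsilon>\<^sub>1], intro conjI ec, rule exI[of _ c], intro conjI ec allI impI; elim conjE)
    fix \<epsilon> T :: real
    assume \<epsilon>: "0 < \<epsilon>" "\<epsilon> \<le> \<epsilon>\<^sub>1" and T_pos: "0 < T"
      and life: "a < 0 \<longrightarrow> T \<le> c * \<epsilon> powr (- (p - 1) / (- a))"
        "a = 0 \<longrightarrow> T \<le> exp (c * \<epsilon> powr (- (p - 1)))"
    define \<alpha> where "\<alpha> y = \<epsilon> * (deriv f y + g y)" for y
    define \<beta> where "\<beta> y = \<epsilon> * (g y - deriv f y)" for y
    have "A * \<epsilon> powr (p - 1) * wt_mass a (T + R) \<le> 1/2"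
      using small \<epsilon> T_pos life by (simp add: lifespan_bound_def)
    moreover have "p * (2 * (\<epsilon> * M)) powr (p - 1) = A * \<epsilon> powr (p - 1)"
      using \<epsilon> pos by (simp add: A_def M_def powr_mult mult_ac)
    moreover have "\<bar>\<alpha> y\<bar> \<le> \<epsilon> * M" "\<bar>\<beta> y\<bar> \<le> \<epsilon> * M" for y
      using bounds(1,2)[of y] \<epsilon>(1)
      by (auto simp: \<alpha>_def \<beta>_def M_def f'_def abs_mult)
    ultimately interpret small_data p a R T "\<epsilon> * M" \<alpha> \<beta>
      using assms(1) T_pos \<epsilon> pos van Ck_continuous[OF f'] Ck_continuous[OF g]
      by unfold_locales (auto simp: \<alpha>_def[abs_def] \<beta>_def[abs_def] M_def f'_def intro!: continuous_intros)
    show "\<exists>u. classical_solution p a f g \<epsilon> T u" if "2 \<le> p"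
    proof -
      define \<alpha>' where "\<alpha>' y = \<epsilon> * (deriv f' y + deriv g y)" for y
      define \<beta>' where "\<beta>' y = \<epsilon> * (deriv g y - deriv f' y)" for y
      have der: "(\<alpha> has_real_derivative \<alpha>' y) (at y)" "(\<beta> has_real_derivative \<beta>' y) (at y)" for y
        unfolding \<alpha>_def[abs_def] \<alpha>'_def \<beta>_def[abs_def] \<beta>'_def f'_def[symmetric]
        by (intro DERIV_cmult DERIV_add DERIV_diff Ck_Suc_D(1)[OF f'] Ck_Suc_D(1)[OF g])+
      have bd: "\<bar>\<alpha>' y\<bar> \<le> \<epsilon> * (Nf + Ng)" "\<bar>\<beta>' y\<bar> \<le> \<epsilon> * (Nf + Ng)" for y
        using bounds(3,4)[of y] \<epsilon>(1) by (auto simp: \<alpha>'_def \<beta>'_def abs_mult)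
      have cont'': "continuous_on UNIV \<alpha>'" "continuous_on UNIV \<beta>'"
        unfolding \<alpha>'_def[abs_def] \<beta>'_def[abs_def]
        by (intro continuous_intros Ck_continuous[OF Ck_Suc_D(2)[OF f']]
            Ck_continuous[OF Ck_Suc_D(2)[OF g]])+
      interpret small_data_C1 p a R T "\<epsilon> * M" \<alpha> \<beta> "\<epsilon> * (Nf + Ng)" \<alpha>' \<beta>'
        using that der bd cont'' \<epsilon> pos by unfold_locales auto
      obtain U W where U: "admissible U" "\<And>x t. t \<in> {0..T} \<Longrightarrow> U x t = solve U x t"
        and W: "continuous_on (strip T) (case_prod W)"
          "\<And>x t. t \<in> {0..T} \<Longrightarrow> ((\<lambda>y. U y t) has_real_derivative W x t) (at x)"
        by (rule picard_limit_C1) blast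
      have cU: "continuous_on (strip T) (case_prod U)" using U(1) by (simp add: admissible_def)
      define u where "u x t = \<epsilon> * f x + ray_int 0 (solve U) x t" for x t
      have \<phi>: "((\<lambda>y. \<epsilon> * f y) has_real_derivative 1/2 * (\<alpha> y - \<beta> y)) (at y)" for y
        using DERIV_cmult[OF Ck_Suc_D(1)[OF f], of \<epsilon> y] by (simp add: \<alpha>_def \<beta>_def algebra_simps)
      have dU: "((\<lambda>y. source p a U y t) has_real_derivative source_dx p a U W x t) (at x)"
        if "t \<in> {0..T}" for x t
        using W(2)[OF that] by (rule source_has_derivative[OF p])
      note potential = wave_potential[OF T_pos \<phi> der(1) cont''(1) der(2) cont''(2)
          continuous_on_source[OF p cU] continuous_on_source_dx[OF p cU W(1)]]
      have u: "Ck_strip 2 T u"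
        unfolding u_def[abs_def] by (rule potential(1)[OF dU])
      have ut: "dt T u x t = U x t" if "t \<in> {0..T}" for x t
        unfolding u_def[abs_def] U(2)[OF that] by (rule potential(2)[OF dU that])
      have eq: "dt T (dt T u) x t - dx (dx u) x t = source p a U x t" if "t \<in> {0..T}" for x t
        unfolding u_def[abs_def] by (rule potential(3)[OF dU that])
      have "U x 0 = \<epsilon> * g x" for x
        using U(2)[of 0 x] T by (simp add: wave_def transport_def \<alpha>_def \<beta>_def algebra_simps)
      then have "classical_solution p a f g \<epsilon> T u"
        using u eq ut T by (simp add: classical_solution_def u_def[of _ 0] source_def wt_def)
      then show ?thesis by blast
    qed
    show "\<exists>U. continuous_on (strip T) (\<lambda>(x, t). U x t) \<and>
            supp (strip T) (\<lambda>(x, t). U x t) \<subseteq> {(x, t) \<in> strip T. \<bar>x\<bar> \<le> t + R} \<and>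
            (\<forall>x. \<forall>t\<in>{0..T}.
               U x t = \<epsilon> * free_dt f g x t + L' a (\<lambda>y s. \<bar>U y s\<bar> powr p) x t)"
    proof -
      obtain U where U: "admissible U" "\<And>x t. t \<in> {0..T} \<Longrightarrow> U x t = solve U x t"
        by (rule picard_limit) blast
      have "{(x, t) \<in> strip T. \<bar>x\<bar> \<le> t + R} = strip T \<inter> {z. \<bar>fst z\<bar> \<le> snd z + R}"
        by auto
      moreover have "closed (strip T)" by (simp add: strip_def closed_Times)
      ultimately have "closed {(x, t) \<in> strip T. \<bar>x\<bar> \<le> t + R}"
        by (auto intro!: closed_Int closed_Collect_le continuous_intros)
      then have "supp (strip T) (\<lambda>(x, t). U x t) \<subseteq> {(x, t) \<in> strip T. \<bar>x\<bar> \<le> t + R}"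
        unfolding supp_def
        by (rule closure_minimal[rotated])
          (use U(1) in \<open>force simp: support_on_def admissible_def strip_def\<close>)
      moreover have "U x t = \<epsilon> * free_dt f g x t + L' a (\<lambda>y s. \<bar>U y s\<bar> powr p) x t"
        if "t \<in> {0..T}" for x t
        using U(2)[OF that, of x] wave_eq_integral_equation[of \<epsilon> f g p a U x t]
        by (simp add: \<alpha>_def[abs_def] \<beta>_def[abs_def])
      ultimately show ?thesis using U(1) by (auto simp: admissible_def)
    qed
  qed
qed

end
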